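(* Let $H$ be a graph, $t\ge1$, $G=H\square K_2^{\square t}=(V,E)$, let $(G,p)$ be a framework in $\mathbb{R}^d$ with $t$-fold extrusion symmetry, let $\Gamma=\mathbb{Z}_2^t$, $r=2^t$, and let $\theta:\Gamma\to\mathrm{Aut}(G)$ be the extrusion action. Then there exist non-singular matrices $A$ (of size $d|V|\times d|V|$) and $B$ (of size $|E|\times|E|$) such that $B^{\top}R(G,p)A$ is block-decomposed as $$B^{\top}R(G,p)A=\widetilde R(G,p)=\begin{pmatrix}\widetilde R_0(G,p)& &\mathbf 0\\ &\ddots& \\ \mathbf 0& &\widetilde R_{r-1}(G,p)\end{pmatrix},$$ where the submatrix block $\widetilde R_\kappa(G,p)$ corresponds to the $\kappa$-th irreducible representation $\rho_\kappa$ of $\Gamma$.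
   Context: Graphs are finite and simple. A (bar-joint) framework $(G,p)$ in $\mathbb{R}^d$ is a graph $G=(V,E)$ with a map $p:V\to\mathbb{R}^d$, $p_i=p(i)$. The rigidity matrix $R(G,p)$ is the $|E|\times d|V|$ matrix whose row for $e=\{i,j\}\in E$ is zero except possibly in the $d$ columns of $i$, where it is $p_i-p_j$, and in the $d$ columns of $j$, where it is $p_j-p_i$. $H\square K_2^{\square t}$ is the Cartesian product of $H$ with $t$ copies of $K_2$, where $V(K_2)=\{0,1\}$: its vertices are $(v,\mathbf e)$ with $v\in V(H)$, $\mathbf e\in\{0,1\}^t$; its edges are $\{(v,\mathbf e),(w,\mathbf e)\}$ with $\{v,w\}\in E(H)$, and $\{(v,\mathbf e),(v,\mathbf e')\}$ with $\mathbf e,\mathbf e'$ differing in exactly one entry. $\Gamma=\mathbb{Z}_2^t$ is the additive group $\{0,1\}^t$ modulo $2$. The extrusion action is $\theta(\gamma)(v,\mathbf e)=(v,\mathbf e+\gamma)$; write $\gamma i$ for $\theta(\gamma)(i)$, and $\gamma e$ for the induced action on edges. $(G,p)$ has $t$-fold extrusion symmetry if there are $\tau_1,\ldots,\tau_t\in\mathbb{R}^d\setminus\{0\}$ such that for every vertex $(v,\mathbf e)$ and every $\gamma\in\Gamma$, $p_{\gamma(v,\mathbf e)}=p_{(v,\mathbf e)}+\sum_{i\in X}\tau_i-\sum_{g\in Y}\tau_g$, where $X$ is the set of indices at which $\mathbf e$ has entry $0$ and $\gamma$ has entry $1$, and $Y$ is the set of indices at which both $\mathbf e$ and $\gamma$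 have entry $1$. $P_V(\gamma)=[\delta_{i,\gamma j}]_{i,j}$ and $P_E(\gamma)$ are the permutation matrices of $\gamma$ on $V$ and $E$. The external representation is $P_V\otimes I_d$ on $\mathbb{R}^{d|V|}$. The internal representation $P'_E$ on $\mathbb{R}^{|E|}$ is obtained from $P_E$ by: for each $\gamma$ and each edge $e=\{(v,\mathbf e),(v,\mathbf e')\}$ with $\mathbf e,\mathbf e'$ differing exactly in the $h$-th entry, with $f=\gamma e$, replace the $1$ in the $(e,f)$ and $(f,e)$ entries of $P_E(\gamma)$ by $-1$ if and only if $\gamma$ has a $1$ in the $h$-th entry. The $r=2^t$ irreducible representations of $\Gamma$ are $\rho_\gamma:\Gamma\to\{1,-1\}$, $\rho_\gamma(\gamma')=(-1)^{x_1'x_1+\dots+x_t'x_t}$ for $\gamma=(x_1,\ldots,x_t)$, $\gamma'=(x'_1,\ldots,x'_t)$; they are enumerated $\rho_0,\ldots,\rho_{r-1}$. Let $X^{(\rho_\kappa)}\subseteq\mathbb{R}^{d|V|}$ and $Y^{(\rho_\kappa)}\subseteq\mathbb{R}^{|E|}$ be the subspaces of vectors on which every $\gamma\in\Gamma$ acts (through $P_V\otimes I_d$, resp. $P'_E$) as multiplication by $\rho_\kappa(\gamma)$; these give direct sum decompositions of $\mathbb{R}^{d|V|}$ and $\mathbb{R}^{|E|}$. That the block $\widetilde R_\kappa(G,p)$ corresponds to $\rho_\kappa$ means that its columns are indexed by those columns of $A$ which form a basis of $X^{(\rho_\kappa)}$ and its rows by those columns of $B$ which form a basis of $Y^{(\rho_\kappa)}$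 (blocks need not be square and may be empty). *)

theory Defs
  imports "Jordan_Normal_Form.VS_Connect" "HOL-Library.Z2"
begin

text \<open>Graphs are given by a vertex set and a set of two-element edges. Matrices whose rows or columns
  belong to vertices or edges are taken with respect to duplicate-free enumerations \<open>vs\<close>, \<open>es\<close> of
  these sets; coordinate \<open>c < d\<close> of the vertex \<open>vs ! i\<close> is number \<open>i * d + c\<close>.\<close>

definition fin_simple_graph :: "'a set \<Rightarrow> 'a set set \<Rightarrow> bool" where
  "fin_simple_graph V E \<longleftrightarrow> finite V \<and> (\<forall>e\<in>E. e \<subseteq> V \<and> card e = 2)"

definition framework :: "nat \<Rightarrow> 'a set \<Rightarrow> 'a set set \<Rightarrow> ('a \<Rightarrow> real vec) \<Rightarrow> bool" where
  "framework d V E p \<longleftrightarrow> fin_simple_graph V E \<and> (\<forall>i\<in>V. p i \<in> carrier_vec d)"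

definition rigidity_matrix ::
  "nat \<Rightarrow> 'a list \<Rightarrow> 'a set list \<Rightarrow> ('a \<Rightarrow> real vec) \<Rightarrow> real mat" where
  "rigidity_matrix d vs es p = mat (length es) (d * length vs) (\<lambda>(a, k).
     let i = vs ! (k div d); c = k mod d in
     if i \<in> es ! a then (p i - p (THE j. es ! a = {i, j})) $ c else 0)"

text \<open>This set is both $\{0,1\}^t$ and, under vector addition over the two-element field, $\Gamma$.\<close>

definition Z2_power :: "nat \<Rightarrow> bit vec set" where
  "Z2_power t = carrier_vec t"

definition differ_only_at :: "nat \<Rightarrow> nat \<Rightarrow> bit vec \<Rightarrow> bit vec \<Rightarrow> bool" where
  "differ_only_at t h e e' \<longleftrightarrow> h < t \<and> (\<forall>i<t. e $ i \<noteq> e' $ i \<longleftrightarrow> i = h)"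

definition extr_verts :: "nat \<Rightarrow> 'a set \<Rightarrow> ('a \<times> bit vec) set" where
  "extr_verts t V = V \<times> Z2_power t"

definition extr_edges :: "nat \<Rightarrow> 'a set \<Rightarrow> 'a set set \<Rightarrow> ('a \<times> bit vec) set set" where
  "extr_edges t V E =
     {{(v, e), (w, e)} | v w e. {v, w} \<in> E \<and> e \<in> Z2_power t} \<union>
     {{(v, e), (v, e')} | v e e'. v \<in> V \<and> e \<in> Z2_power t \<and> e' \<in> Z2_power t \<and>
        (\<exists>h. differ_only_at t h e e')}"

definition extr_act :: "bit vec \<Rightarrow> 'a \<times> bit vec \<Rightarrow> 'a \<times> bit vec" where
  "extr_act \<gamma> = (\<lambda>(v, e). (v, e + \<gamma>))"

definition extr_act_edge :: "bit vec \<Rightarrow> ('a \<times> bit vec) set \<Rightarrow> ('a \<times> bit vec) set" where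
  "extr_act_edge \<gamma> f = extr_act \<gamma> ` f"

definition extrusion_symmetric ::
  "nat \<Rightarrow> nat \<Rightarrow> 'a set \<Rightarrow> ('a \<times> bit vec \<Rightarrow> real vec) \<Rightarrow> bool" where
  "extrusion_symmetric d t V p \<longleftrightarrow> (\<exists>\<tau> :: nat \<Rightarrow> real vec.
     (\<forall>h<t. \<tau> h \<in> carrier_vec d - {0\<^sub>v d}) \<and>
     (\<forall>v\<in>V. \<forall>e\<in>Z2_power t. \<forall>\<gamma>\<in>Z2_power t.
        p (extr_act \<gamma> (v, e)) = p (v, e)
          + finsum_vec TYPE(real) d \<tau> {h. h < t \<and> e $ h = 0 \<and> \<gamma> $ h = 1}
          - finsum_vec TYPE(real) d \<tau> {h. h < t \<and> e $ h = 1 \<and> \<gamma> $ h = 1}))"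

definition kronecker_product :: "real mat \<Rightarrow> real mat \<Rightarrow> real mat" where
  "kronecker_product M N = mat (dim_row M * dim_row N) (dim_col M * dim_col N) (\<lambda>(i, j).
     M $$ (i div dim_row N, j div dim_col N) * N $$ (i mod dim_row N, j mod dim_col N))"

definition vert_perm_mat :: "('a \<times> bit vec) list \<Rightarrow> bit vec \<Rightarrow> real mat" where
  "vert_perm_mat vs \<gamma> = mat (length vs) (length vs) (\<lambda>(i, j).
     if vs ! i = extr_act \<gamma> (vs ! j) then 1 else 0)"

definition edge_perm_mat :: "('a \<times> bit vec) set list \<Rightarrow> bit vec \<Rightarrow> real mat" where
  "edge_perm_mat es \<gamma> = mat (length es) (length es) (\<lambda>(a, b).
     if es ! a = extr_act_edge \<gamma> (es ! b) then 1 else 0)"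

definition external_rep :: "nat \<Rightarrow> ('a \<times> bit vec) list \<Rightarrow> bit vec \<Rightarrow> real mat" where
  "external_rep d vs \<gamma> = kronecker_product (vert_perm_mat vs \<gamma>) (1\<^sub>m d)"

definition reversed_edge :: "nat \<Rightarrow> bit vec \<Rightarrow> ('a \<times> bit vec) set \<Rightarrow> bool" where
  "reversed_edge t \<gamma> f \<longleftrightarrow> (\<exists>v e e' h. e \<in> Z2_power t \<and> e' \<in> Z2_power t \<and>
     f = {(v, e), (v, e')} \<and> differ_only_at t h e e' \<and> \<gamma> $ h = 1)"

text \<open>The two disjuncts are the $(e, \gamma e)$ and $(\gamma e, e)$ entries whose $1$ is replaced.\<close>

definition internal_rep :: "nat \<Rightarrow> ('a \<times> bit vec) set list \<Rightarrow> bit vec \<Rightarrow> real mat" where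
  "internal_rep t es \<gamma> = mat (length es) (length es) (\<lambda>(a, b).
     if reversed_edge t \<gamma> (es ! a) \<and> es ! b = extr_act_edge \<gamma> (es ! a) \<or>
        reversed_edge t \<gamma> (es ! b) \<and> es ! a = extr_act_edge \<gamma> (es ! b)
     then - 1 else edge_perm_mat es \<gamma> $$ (a, b))"

definition irrep :: "nat \<Rightarrow> bit vec \<Rightarrow> bit vec \<Rightarrow> real" where
  "irrep t \<gamma> \<gamma>' = (- 1) ^ (\<Sum>h<t. of_bit (\<gamma>' $ h) * of_bit (\<gamma> $ h))"

definition isotypic_subspace ::
  "nat \<Rightarrow> nat \<Rightarrow> (bit vec \<Rightarrow> real mat) \<Rightarrow> (bit vec \<Rightarrow> real) \<Rightarrow> real vec set" where
  "isotypic_subspace t n P \<rho> =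
     {x \<in> carrier_vec n. \<forall>\<gamma>\<in>Z2_power t. P \<gamma> *\<^sub>v x = \<rho> \<gamma> \<cdot>\<^sub>v x}"

definition is_basis_of :: "nat \<Rightarrow> real vec list \<Rightarrow> real vec set \<Rightarrow> bool" where
  "is_basis_of n xs W \<longleftrightarrow> distinct xs \<and>
     vectorspace.basis class_ring (module_vec TYPE(real) n\<lparr>carrier := W\<rparr>) (set xs)"

text \<open>Block number \<open>\<kappa>\<close> of \<open>diag_block_mat Rs\<close> occupies consecutive columns (rows) starting after
  those of the previous blocks; these lists are the columns of \<open>A\<close> (of \<open>B\<close>) that index the columns
  (rows) of that block in $B^\top R A$.\<close>

definition block_columns :: "real mat list \<Rightarrow> nat \<Rightarrow> real mat \<Rightarrow> real vec list" where
  "block_columns Rs \<kappa> A = (let k = sum_list (map dim_col (take \<kappa> Rs)) in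
     map (col A) [k..<k + dim_col (Rs ! \<kappa>)])"

definition block_rows :: "real mat list \<Rightarrow> nat \<Rightarrow> real mat \<Rightarrow> real vec list" where
  "block_rows Rs \<kappa> B = (let k = sum_list (map dim_row (take \<kappa> Rs)) in
     map (col B) [k..<k + dim_row (Rs ! \<kappa>)])"

end

theory Submission
  imports Defs "Jordan_Normal_Form.DL_Rank"
begin

text \<open>
  Both representations of \<open>\<Gamma>\<close> act by symmetric matrices, so their isotypic subspaces are pairwise
  orthogonal, and averaging against the characters shows that they span. Concatenating bases of
  the isotypic subspaces therefore gives non-singular matrices \<open>A\<close> and \<open>B\<close>. Translating by \<open>\<gamma>\<close>
  preserves the edge vectors $p_i - p_j$, except that those of the fibre edges in a direction \<open>h\<close> with
  $\gamma_h = 1$ are reversed; these are the signs of the internal representation, so the rigidity matrix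
  intertwines the two representations. It then maps each isotypic subspace
  into the one with the same character, and by orthogonality all off-diagonal blocks vanish.
\<close>

section \<open>Bases of subspaces and characters\<close>

text \<open>Every element of \<Gamma> is its own inverse, so its permutation matrices are symmetric.
  The signs do not spoil this: whether \<gamma> reverses an edge depends only on the direction of
  the edge, and translation preserves directions. Since B enters transposed and not inverted, an
  entry of the product is \<open>y \<bullet> (R *\<^sub>v x)\<close> for basis vectors y and x.
  Orthogonality is therefore used only between different isotypic subspaces, and the basis inside
  each of them is arbitrary. An isotypic subspace may be zero and its dimensions on the two sides
  may differ, so blocks may be empty or non-square; no single dimension is ever computed. Both
  representations are instances of one object, a signed permutation action on labelled points: the
  sign is trivial on vertex coordinates and depends on the direction for edges. Geometry then enters
  only through an equivariance identity for the single entries of the rigidity matrix.\<close>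

lemma invertible_mat_if_det_nonzero:
  fixes A :: "'a :: field mat"
  assumes A: "A \<in> carrier_mat n n" and "det A \<noteq> 0"
  shows "invertible_mat A"
proof -
  have "A \<in> Units (ring_mat TYPE('a) n ())"
    using assms by (rule det_non_zero_imp_unit)
  then show ?thesis
    using A unfolding Units_def ring_mat_simps invertible_mat_def inverts_mat_def
    by (auto simp: square_mat.simps)
qed

context vec_space
begin

text \<open>Independent sets in \<open>W\<close> stay independent in the ambient space, so their
  size is bounded and a maximal one exists. The zero subspace gets the empty basis.\<close>

lemma subspace_basis:
  assumes W: "subspace class_ring W V"
  obtains b where "finite b" "vectorspace.basis class_ring (vs W) b"
proof -
  have sub: "submodule class_ring W V" using W by (simp add: subspace_def)
  then have WC: "W \<subseteq> carrier_vec n" by (simp add: submodule_def)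
  interpret w: vectorspace class_ring "vs W" using W by (rule subspace_is_vs)
  have li: "w.lin_indpt S \<longleftrightarrow> lin_indpt S" if "S \<subseteq> W" for S
    using span_li_not_depend(2)[OF that sub] by simp
  have "\<exists>b. finite b \<and> maximal b (\<lambda>S. S \<subseteq> carrier (vs W) \<and> w.lin_indpt S)"
  proof (rule maximal_exists)
    fix S assume "S \<subseteq> carrier (vs W) \<and> w.lin_indpt S"
    then have "S \<subseteq> carrier_vec n" "lin_indpt S" using li WC by auto
    then show "finite S \<and> card S \<le> dim" using li_le_dim by auto
  next
    show "{} \<subseteq> carrier (vs W) \<and> w.lin_indpt {}" by (auto simp: w.lin_dep_def)
  qed
  then show thesis using that w.max_li_is_basis by blast
qed

text \<open>\<open>is_basis_of\<close> refers to span and independence inside the subspace;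
  combining vectors of different isotypic subspaces requires both notions in the ambient
  space.\<close>

lemma subspace_basis_iff:
  assumes W: "subspace class_ring W V"
  shows "vectorspace.basis class_ring (vs W) b \<longleftrightarrow> b \<subseteq> W \<and> lin_indpt b \<and> span b = W"
proof -
  have sub: "submodule class_ring W V" using W by (simp add: subspace_def)
  interpret w: vectorspace class_ring "vs W" using W by (rule subspace_is_vs)
  show ?thesis
    unfolding w.basis_def using span_li_not_depend[OF _ sub, of b] by auto
qed

lemma invertible_mat_of_basis:
  assumes "distinct xs" "basis (set xs)"
  shows "length xs = n" and "invertible_mat (mat_of_cols n xs)"
proof -
  have "dim = card (set xs)" using assms(2) by (intro dim_basis) auto
  then show len: "length xs = n" using assms(1) by (simp add: dim_is_n distinct_card)
  have xs: "set xs \<subseteq> carrier_vec n" and li: "lin_indpt (set xs)"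
    using assms(2) unfolding basis_def by blast+
  have A: "mat_of_cols n xs \<in> carrier_mat n n" using mat_of_cols_carrier(1)[of n xs] unfolding len .
  have "rank (mat_of_cols n xs) = n"
    using A assms(1) li xs by (intro lin_indpt_full_rank) auto
  then show "invertible_mat (mat_of_cols n xs)"
    using A det_rank_iff invertible_mat_if_det_nonzero by blast
qed

end

section \<open>The group \<Gamma> and its characters\<close>

lemma finite_Z2_power: "finite (Z2_power t)"
proof (rule inj_on_finite)
  show "inj_on (\<lambda>\<gamma>. {i. i < t \<and> \<gamma> $ i = 1}) (Z2_power t)"
  proof (rule inj_onI)
    fix \<gamma> \<delta> assume *: "\<gamma> \<in> Z2_power t" "\<delta> \<in> Z2_power t"
      "{i. i < t \<and> \<gamma> $ i = 1} = {i. i < t \<and> \<delta> $ i = 1}"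
    have "\<gamma> $ i = \<delta> $ i" if "i < t" for i
    proof -
      have "\<gamma> $ i = 1 \<longleftrightarrow> \<delta> $ i = 1" using *(3) that by blast
      then show ?thesis by (cases "\<gamma> $ i"; cases "\<delta> $ i") simp_all
    qed
    then show "\<gamma> = \<delta>" using * by (auto simp: Z2_power_def vec_eq_iff)
  qed
  show "(\<lambda>\<gamma>. {i. i < t \<and> \<gamma> $ i = 1}) ` Z2_power t \<subseteq> Pow {..<t}" by auto
qed simp

lemma Z2_power_closed [simp, intro]:
  "\<gamma> \<in> Z2_power t \<Longrightarrow> \<delta> \<in> Z2_power t \<Longrightarrow> \<gamma> + \<delta> \<in> Z2_power t"
  "0\<^sub>v t \<in> Z2_power t"
  by (auto simp: Z2_power_def)

lemma Z2_power_add_self [simp]: "\<gamma> \<in> Z2_power t \<Longrightarrow> \<gamma> + \<gamma> = 0\<^sub>v t"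
  by (auto simp: Z2_power_def)

lemma Z2_power_add_cancel:
  assumes "\<gamma> \<in> Z2_power t" "\<delta> \<in> Z2_power t"
  shows "\<delta> + \<gamma> + \<gamma> = \<delta>"
  using assms by (auto simp: Z2_power_def)

lemma irrep_eq_prod:
  "irrep t \<kappa> \<gamma> = (\<Prod>h<t. if \<kappa> $ h = 1 \<and> \<gamma> $ h = 1 then - 1 else 1)"
proof -
  have "(- 1) ^ (of_bit (\<gamma> $ h) * of_bit (\<kappa> $ h)) = (if \<kappa> $ h = 1 \<and> \<gamma> $ h = 1 then - 1 else 1 :: real)" for h
    by (cases "\<kappa> $ h"; cases "\<gamma> $ h") simp_all
  then show ?thesis unfolding irrep_def power_sum by simp
qed

lemma irrep_commute: "irrep t \<kappa> \<gamma> = irrep t \<gamma> \<kappa>"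
  by (simp add: irrep_def mult.commute)

text \<open>This holds factor by factor in the product form: the bits satisfy 1 + 1 = 0 just as two
  factors -1 multiply to 1.\<close>

lemma irrep_add_right:
  assumes "\<gamma> \<in> Z2_power t" "\<delta> \<in> Z2_power t"
  shows "irrep t \<kappa> (\<gamma> + \<delta>) = irrep t \<kappa> \<gamma> * irrep t \<kappa> \<delta>"
proof -
  have "(if \<kappa> $ h = 1 \<and> (\<gamma> + \<delta>) $ h = 1 then - 1 else 1 :: real)
      = (if \<kappa> $ h = 1 \<and> \<gamma> $ h = 1 then - 1 else 1) * (if \<kappa> $ h = 1 \<and> \<delta> $ h = 1 then - 1 else 1)"
    if "h < t" for h
    using assms that unfolding Z2_power_def by (cases "\<gamma> $ h"; cases "\<delta> $ h") simp_all
  then show ?thesis unfolding irrep_eq_prod prod.distrib[symmetric] by (intro prod.cong) auto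
qed

lemma irrep_separates:
  assumes "\<kappa> \<in> Z2_power t" "\<mu> \<in> Z2_power t" "\<kappa> \<noteq> \<mu>"
  obtains \<gamma> where "\<gamma> \<in> Z2_power t" "irrep t \<kappa> \<gamma> \<noteq> irrep t \<mu> \<gamma>"
proof -
  obtain h where h: "h < t" "\<kappa> $ h \<noteq> \<mu> $ h"
    using assms by (auto simp: Z2_power_def vec_eq_iff)
  \<comment> \<open>Evaluating at the unit vector isolates the one factor in which the two
    characters differ.\<close>
  have unit: "irrep t \<nu> (unit_vec t h) = (if \<nu> $ h = 1 then - 1 else 1)" for \<nu>
  proof -
    have "irrep t \<nu> (unit_vec t h) = (\<Prod>k<t. if k = h then if \<nu> $ h = 1 then - 1 else 1 else 1)"
      unfolding irrep_eq_prod using h by (intro prod.cong) auto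
    then show ?thesis using h by simp
  qed
  have "irrep t \<kappa> (unit_vec t h) \<noteq> irrep t \<mu> (unit_vec t h)"
    using h(2) unfolding unit by (cases "\<kappa> $ h"; cases "\<mu> $ h") auto
  then show thesis using that[of "unit_vec t h"] by (simp add: Z2_power_def)
qed

text \<open>Shifting the summation index by \<delta> multiplies the sum by
  \<open>irrep t \<delta> \<gamma>\<close>, so the sum vanishes once some \<delta> makes this factor
  differ from 1. This is the dual orthogonality relation: the group element is fixed and the
  character varies.\<close>

lemma irrep_sum:
  assumes "\<gamma> \<in> Z2_power t"
  shows "(\<Sum>\<kappa>\<in>Z2_power t. irrep t \<kappa> \<gamma>) = (if \<gamma> = 0\<^sub>v t then real (card (Z2_power t)) else 0)"
proof (cases "\<gamma> = 0\<^sub>v t")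
  case True
  then show ?thesis by (simp add: irrep_eq_prod)
next
  case False
  \<comment> \<open>Element and character play symmetric roles in \<open>irrep\<close>: separating
    \<gamma> from zero as characters yields a \<delta> whose own character is not 1 at
    \<gamma>.\<close>
  then obtain \<delta> where d: "\<delta> \<in> Z2_power t" "irrep t \<gamma> \<delta> \<noteq> irrep t (0\<^sub>v t) \<delta>"
    using irrep_separates assms by (metis Z2_power_closed(2))
  have "irrep t (0\<^sub>v t) \<delta> = 1" by (simp add: irrep_eq_prod)
  with d(2) have ne: "irrep t \<delta> \<gamma> \<noteq> 1" by (metis irrep_commute)
  have "(\<Sum>\<kappa>\<in>Z2_power t. irrep t \<kappa> \<gamma>) = (\<Sum>\<kappa>\<in>Z2_power t. irrep t (\<kappa> + \<delta>) \<gamma>)"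
    by (rule sum.reindex_bij_witness[of _ "\<lambda>\<kappa>. \<kappa> + \<delta>" "\<lambda>\<kappa>. \<kappa> + \<delta>"])
      (use d in \<open>auto simp: Z2_power_add_cancel\<close>)
  also have "\<dots> = (\<Sum>\<kappa>\<in>Z2_power t. irrep t \<kappa> \<gamma>) * irrep t \<delta> \<gamma>"
    unfolding sum_distrib_right
    by (rule sum.cong) (use d in \<open>auto simp: irrep_commute[of t _ \<gamma>] irrep_add_right\<close>)
  finally have "(\<Sum>\<kappa>\<in>Z2_power t. irrep t \<kappa> \<gamma>) * (1 - irrep t \<delta> \<gamma>) = 0"
    by (simp add: algebra_simps)
  then show ?thesis using False ne by simp
qed

section \<open>Representations by symmetric matrices\<close>

lemma scalar_prod_self_eq_0D:
  fixes x :: "real vec"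
  assumes "x \<in> carrier_vec n" "x \<bullet> x = 0"
  shows "x = 0\<^sub>v n"
  using assms by (auto simp: scalar_prod_def sum_nonneg_eq_0_iff)

text \<open>Each \<open>P \<gamma>\<close> is its own inverse, so \<open>P_symmetric\<close> amounts
  to invariance of the standard inner product.\<close>

locale Z2_representation =
  fixes t n :: nat and P :: "bit vec \<Rightarrow> real mat"
  assumes P_carrier [simp]: "\<gamma> \<in> Z2_power t \<Longrightarrow> P \<gamma> \<in> carrier_mat n n"
    and P_add: "\<gamma> \<in> Z2_power t \<Longrightarrow> \<delta> \<in> Z2_power t \<Longrightarrow> P (\<gamma> + \<delta>) = P \<gamma> * P \<delta>"
    and P_zero: "P (0\<^sub>v t) = 1\<^sub>m n"
    and P_symmetric: "\<gamma> \<in> Z2_power t \<Longrightarrow> transpose_mat (P \<gamma>) = P \<gamma>"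
begin

interpretation R: vec_space "TYPE(real)" n .

abbreviation isotypic :: "bit vec \<Rightarrow> real vec set" where
  "isotypic \<kappa> \<equiv> isotypic_subspace t n P (irrep t \<kappa>)"

lemma isotypicD:
  assumes "x \<in> isotypic \<kappa>"
  shows "x \<in> carrier_vec n" and "\<gamma> \<in> Z2_power t \<Longrightarrow> P \<gamma> *\<^sub>v x = irrep t \<kappa> \<gamma> \<cdot>\<^sub>v x"
  using assms by (auto simp: isotypic_subspace_def)

lemma isotypic_subspace: "subspace class_ring (isotypic \<kappa>) R.V"
proof -
  have "P \<gamma> *\<^sub>v (v + w) = irrep t \<kappa> \<gamma> \<cdot>\<^sub>v (v + w)"
    if "v \<in> isotypic \<kappa>" "w \<in> isotypic \<kappa>" "\<gamma> \<in> Z2_power t" for v w \<gamma>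
    using that isotypicD[of v] isotypicD[of w]
    by (simp add: mult_add_distrib_mat_vec[OF P_carrier] smult_add_distrib_vec[of _ n])
  moreover have "P \<gamma> *\<^sub>v (c \<cdot>\<^sub>v v) = irrep t \<kappa> \<gamma> \<cdot>\<^sub>v (c \<cdot>\<^sub>v v)"
    if "v \<in> isotypic \<kappa>" "\<gamma> \<in> Z2_power t" for v c \<gamma>
    using that isotypicD[of v]
    by (simp add: mult_mat_vec[OF P_carrier] smult_smult_assoc mult.commute)
  moreover have "P \<gamma> *\<^sub>v 0\<^sub>v n = irrep t \<kappa> \<gamma> \<cdot>\<^sub>v 0\<^sub>v n" if "\<gamma> \<in> Z2_power t" for \<gamma>
    using P_carrier[OF that] by (intro eq_vecI) auto
  ultimately show ?thesis
    unfolding subspace_def using vec_vs vec_module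
    by (auto intro!: submodule.intro simp: isotypic_subspace_def)
qed

text \<open>For a \<gamma> separating the two characters, x and y satisfy the eigenvector equation
  of one symmetric matrix for two different eigenvalues.\<close>

lemma isotypic_orthogonal:
  assumes "\<kappa> \<in> Z2_power t" "\<mu> \<in> Z2_power t" "\<kappa> \<noteq> \<mu>"
    and x: "x \<in> isotypic \<kappa>" and y: "y \<in> isotypic \<mu>"
  shows "x \<bullet> y = 0"
proof -
  obtain \<gamma> where g: "\<gamma> \<in> Z2_power t" "irrep t \<kappa> \<gamma> \<noteq> irrep t \<mu> \<gamma>"
    using irrep_separates assms(1-3) by blast
  note xy = isotypicD[OF x] isotypicD[OF y]
  have "irrep t \<kappa> \<gamma> * (x \<bullet> y) = (P \<gamma> *\<^sub>v x) \<bullet> y"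
    using xy g by simp
  also have "\<dots> = x \<bullet> (P \<gamma> *\<^sub>v y)"
    using transpose_vec_mult_scalar[OF P_carrier[OF g(1)] xy(3) xy(1)] P_symmetric[OF g(1)] by simp
  also have "\<dots> = irrep t \<mu> \<gamma> * (x \<bullet> y)"
    using xy g by simp
  finally show ?thesis using g(2) by simp
qed

text \<open>The usual character projector. The characters only take the values 1 and -1, so neither
  conjugates nor inverses appear.\<close>

definition isotypic_proj :: "bit vec \<Rightarrow> real vec \<Rightarrow> real vec" where
  "isotypic_proj \<kappa> x = vec n (\<lambda>i.
     (\<Sum>\<gamma>\<in>Z2_power t. irrep t \<kappa> \<gamma> * (P \<gamma> *\<^sub>v x) $ i) / card (Z2_power t))"

lemma isotypic_proj_in:
  assumes x: "x \<in> carrier_vec n"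
  shows "isotypic_proj \<kappa> x \<in> isotypic \<kappa>"
proof -
  let ?N = "real (card (Z2_power t))"
  have "P \<delta> *\<^sub>v isotypic_proj \<kappa> x = irrep t \<kappa> \<delta> \<cdot>\<^sub>v isotypic_proj \<kappa> x" if d: "\<delta> \<in> Z2_power t" for \<delta>
  proof (rule eq_vecI)
    fix i assume "i < dim_vec (irrep t \<kappa> \<delta> \<cdot>\<^sub>v isotypic_proj \<kappa> x)"
    then have i: "i < n" by (simp add: isotypic_proj_def)
    have mv: "(P \<delta> *\<^sub>v y) $ i = (\<Sum>j<n. P \<delta> $$ (i, j) * y $ j)" if "y \<in> carrier_vec n" for y
      using P_carrier[OF d] i that by (auto simp: scalar_prod_def lessThan_atLeast0 intro!: sum.cong)
    have "(P \<delta> *\<^sub>v isotypic_proj \<kappa> x) $ i = (\<Sum>j<n. P \<delta> $$ (i, j) * isotypic_proj \<kappa> x $ j)"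
      by (rule mv) (simp add: isotypic_proj_def)
    also have "\<dots> = (\<Sum>j<n. \<Sum>\<gamma>\<in>Z2_power t. irrep t \<kappa> \<gamma> * (P \<delta> $$ (i, j) * (P \<gamma> *\<^sub>v x) $ j)) / ?N"
      by (simp add: isotypic_proj_def sum_divide_distrib sum_distrib_left mult_ac)
    also have "\<dots> = (\<Sum>\<gamma>\<in>Z2_power t. irrep t \<kappa> \<gamma> * (\<Sum>j<n. P \<delta> $$ (i, j) * (P \<gamma> *\<^sub>v x) $ j)) / ?N"
      by (subst sum.swap) (simp add: sum_distrib_left)
    also have "\<dots> = (\<Sum>\<gamma>\<in>Z2_power t. irrep t \<kappa> \<gamma> * (P (\<delta> + \<gamma>) *\<^sub>v x) $ i) / ?N"
    proof -
      have "(\<Sum>j<n. P \<delta> $$ (i, j) * (P \<gamma> *\<^sub>v x) $ j) = (P (\<delta> + \<gamma>) *\<^sub>v x) $ i" if g: "\<gamma> \<in> Z2_power t" for \<gamma>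
        unfolding P_add[OF d g] assoc_mult_mat_vec[OF P_carrier[OF d] P_carrier[OF g] x]
        by (rule mv[symmetric]) (rule mult_mat_vec_carrier[OF P_carrier[OF g] x])
      then show ?thesis by simp
    qed
    \<comment> \<open>Translation by \<delta> is an involution of \<Gamma>; reindexing by it moves
      \<delta> from the representation into the character, where multiplicativity splits it
      off.\<close>
    also have "\<dots> = (\<Sum>\<gamma>\<in>Z2_power t. irrep t \<kappa> (\<delta> + \<gamma>) * (P \<gamma> *\<^sub>v x) $ i) / ?N"
    proof -
      have "\<delta> + (\<delta> + \<gamma>) = \<gamma>" if "\<gamma> \<in> Z2_power t" for \<gamma>
        using that d by (auto simp: Z2_power_def)
      then show ?thesis
        by (intro arg_cong2[of _ _ _ _ "(/)"] refl sum.reindex_bij_witness[of _ "\<lambda>\<gamma>. \<delta> + \<gamma>" "\<lambda>\<gamma>. \<delta> + \<gamma>"])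
          (use d in auto)
    qed
    also have "\<dots> = (irrep t \<kappa> \<delta> \<cdot>\<^sub>v isotypic_proj \<kappa> x) $ i"
      using i d by (simp add: isotypic_proj_def irrep_add_right sum_distrib_left mult.assoc)
    finally show "(P \<delta> *\<^sub>v isotypic_proj \<kappa> x) $ i = (irrep t \<kappa> \<delta> \<cdot>\<^sub>v isotypic_proj \<kappa> x) $ i" .
  qed (use P_carrier[OF d] in \<open>auto simp: isotypic_proj_def\<close>)
  then show ?thesis by (simp add: isotypic_subspace_def) (simp add: isotypic_proj_def)
qed

text \<open>Fourier inversion: after exchanging the sums, the character sums kill every term except
  \<gamma> = 0, where the representation is the identity.\<close>

lemma isotypic_proj_sum:
  assumes x: "x \<in> carrier_vec n" and i: "i < n"
  shows "(\<Sum>\<kappa>\<in>Z2_power t. isotypic_proj \<kappa> x $ i) = x $ i"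
proof -
  let ?N = "real (card (Z2_power t))"
  have N: "?N \<noteq> 0" using finite_Z2_power Z2_power_closed(2)[of t] by auto
  have "(\<Sum>\<kappa>\<in>Z2_power t. isotypic_proj \<kappa> x $ i)
      = (\<Sum>\<kappa>\<in>Z2_power t. \<Sum>\<gamma>\<in>Z2_power t. irrep t \<kappa> \<gamma> * (P \<gamma> *\<^sub>v x) $ i) / ?N"
    using i by (simp add: isotypic_proj_def sum_divide_distrib)
  also have "\<dots> = (\<Sum>\<gamma>\<in>Z2_power t. (\<Sum>\<kappa>\<in>Z2_power t. irrep t \<kappa> \<gamma>) * (P \<gamma> *\<^sub>v x) $ i) / ?N"
    by (subst sum.swap) (simp add: sum_distrib_right)
  also have "\<dots> = (\<Sum>\<gamma>\<in>Z2_power t. if \<gamma> = 0\<^sub>v t then ?N * x $ i else 0) / ?N"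
    using x by (intro arg_cong2[of _ _ _ _ "(/)"] sum.cong refl) (simp add: irrep_sum P_zero)
  also have "\<dots> = x $ i" using N by (simp add: sum.delta[OF finite_Z2_power])
  finally show ?thesis .
qed

text \<open>In a vanishing combination, the part x belonging to one character is orthogonal to all
  the other parts, hence to itself, and so is zero; independence within that character then kills
  its coefficients.\<close>

lemma lin_indpt_Union_isotypic:
  assumes b: "\<And>\<kappa>. \<kappa> \<in> Z2_power t \<Longrightarrow> finite (b \<kappa>) \<and> b \<kappa> \<subseteq> isotypic \<kappa> \<and> R.lin_indpt (b \<kappa>)"
  shows "R.lin_indpt (\<Union>\<kappa>\<in>Z2_power t. b \<kappa>)"
proof (rule R.finite_lin_indpt2)
  let ?U = "\<Union>\<kappa>\<in>Z2_power t. b \<kappa>"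
  show fin: "finite ?U" using b finite_Z2_power by auto
  show U: "?U \<subseteq> carrier_vec n" using b isotypicD(1) by blast
  fix a :: "real vec \<Rightarrow> real"
  assume a: "R.lincomb a ?U = 0\<^sub>v n"
  show "\<forall>v\<in>?U. a v = 0"
  proof
    fix v assume "v \<in> ?U"
    then obtain \<kappa> where k: "\<kappa> \<in> Z2_power t" "v \<in> b \<kappa>" by auto
    note bk = b[OF k(1)]
    define x where "x = R.lincomb a (b \<kappa>)"
    have bc: "b \<kappa> \<subseteq> carrier_vec n" using bk isotypicD(1) by blast
    then have xc: "x \<in> carrier_vec n" unfolding x_def by (intro R.lincomb_closed) auto
    have xi: "x \<in> isotypic \<kappa>"
    proof -
      have "x \<in> R.span (b \<kappa>)" unfolding x_def using bk by auto
      then show ?thesis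
        using R.span_is_subset[of "b \<kappa>" "isotypic \<kappa>"] bk isotypic_subspace
        by (auto simp: subspace_def)
    qed
    have sp: "R.lincomb a S \<bullet> x = (\<Sum>u\<in>S. a u * (u \<bullet> x))" if "S \<subseteq> carrier_vec n" for S
      unfolding R.lincomb_def using that xc
      by (subst R.finsum_scalar_prod_sum) (auto intro!: sum.cong)
    have "x \<bullet> x = (\<Sum>u\<in>b \<kappa>. a u * (u \<bullet> x))"
      using sp[OF bc] by (simp add: x_def)
    also have "\<dots> = (\<Sum>u\<in>?U. a u * (u \<bullet> x))"
    proof (rule sum.mono_neutral_left[OF fin])
      show "b \<kappa> \<subseteq> ?U" using k(1) by auto
      show "\<forall>u\<in>?U - b \<kappa>. a u * (u \<bullet> x) = 0"
      proof
        fix u assume u: "u \<in> ?U - b \<kappa>"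
        then obtain \<mu> where m: "\<mu> \<in> Z2_power t" "u \<in> b \<mu>" by auto
        with u have "\<mu> \<noteq> \<kappa>" by auto
        then have "u \<bullet> x = 0" using isotypic_orthogonal[OF m(1) k(1) _ _ xi] b m by blast
        then show "a u * (u \<bullet> x) = 0" by simp
      qed
    qed
    also have "\<dots> = 0" using sp[OF U] a xc by simp
    finally have "x = 0\<^sub>v n" using scalar_prod_self_eq_0D[OF xc] by simp
    then show "a v = 0"
      using R.not_lindepD[of "b \<kappa>" "b \<kappa>" a] bk k(2) unfolding x_def by auto
  qed
qed

text \<open>Orthogonality gives independence and the projections give spanning, so the total length
  n results without knowing the length of any single list.\<close>

lemma isotypic_bases:
  assumes \<iota>: "bij_betw \<iota> {..<2 ^ t :: nat} (Z2_power t)"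
  obtains Xs where "length Xs = 2 ^ t"
    and "\<And>\<kappa>. \<kappa> < 2 ^ t \<Longrightarrow> is_basis_of n (Xs ! \<kappa>) (isotypic (\<iota> \<kappa>))"
    and "\<And>\<kappa>. \<kappa> < 2 ^ t \<Longrightarrow> set (Xs ! \<kappa>) \<subseteq> isotypic (\<iota> \<kappa>)"
    and "length (concat Xs) = n" and "invertible_mat (mat_of_cols n (concat Xs))"
proof -
  have "\<exists>xs. distinct xs \<and> vectorspace.basis class_ring (R.vs (isotypic \<kappa>)) (set xs)" for \<kappa>
    using R.subspace_basis[OF isotypic_subspace] finite_distinct_list by metis
  then obtain bs where bs: "\<And>\<kappa>. distinct (bs \<kappa>)"
    "\<And>\<kappa>. vectorspace.basis class_ring (R.vs (isotypic \<kappa>)) (set (bs \<kappa>))"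
    by metis
  have bas: "set (bs \<kappa>) \<subseteq> isotypic \<kappa>" "R.lin_indpt (set (bs \<kappa>))" "R.span (set (bs \<kappa>)) = isotypic \<kappa>" for \<kappa>
    using bs(2)[of \<kappa>] R.subspace_basis_iff[OF isotypic_subspace] by auto
  define Xs where "Xs = map (\<lambda>k. bs (\<iota> k)) [0..<2 ^ t]"
  have im: "\<iota> ` {..<2 ^ t} = Z2_power t" and inj: "inj_on \<iota> {..<2 ^ t}"
    using \<iota> by (auto simp: bij_betw_def)
  have set: "set (concat Xs) = (\<Union>\<kappa>\<in>Z2_power t. set (bs \<kappa>))"
    unfolding Xs_def im[symmetric] by (auto simp: lessThan_atLeast0)
  have car: "set (concat Xs) \<subseteq> carrier_vec n"
    unfolding set using bas(1) isotypicD(1) by blast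
  \<comment> \<open>A common vector would be orthogonal to itself, hence zero, and zero belongs to
    no independent set.\<close>
  have disj: "set (bs \<kappa>) \<inter> set (bs \<mu>) = {}" if "\<kappa> \<in> Z2_power t" "\<mu> \<in> Z2_power t" "\<kappa> \<noteq> \<mu>" for \<kappa> \<mu>
  proof (rule ccontr)
    assume "set (bs \<kappa>) \<inter> set (bs \<mu>) \<noteq> {}"
    then obtain x where x: "x \<in> set (bs \<kappa>)" "x \<in> set (bs \<mu>)" by auto
    then have xi: "x \<in> isotypic \<kappa>" "x \<in> isotypic \<mu>" using bas(1) by auto
    have "x \<bullet> x = 0" using isotypic_orthogonal[OF that xi] .
    then have "x = 0\<^sub>v n" using scalar_prod_self_eq_0D[OF isotypicD(1)[OF xi(1)]] by simp
    then show False using x(1) bas(2)[of \<kappa>] R.vs_zero_lin_dep[of "set (bs \<kappa>)"] bas(1) isotypicD(1)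
      by auto
  qed
  have "distinct (concat Xs)"
  proof -
    \<comment> \<open>Several isotypic subspaces may be zero and contribute the same empty list, so
      distinctness is asked of the indices and not of the lists.\<close>
    have "distinct (concat (map f ks))"
      if "distinct ks" "\<And>k. k \<in> set ks \<Longrightarrow> distinct (f k)"
        "\<And>k l. k \<in> set ks \<Longrightarrow> l \<in> set ks \<Longrightarrow> k \<noteq> l \<Longrightarrow> set (f k) \<inter> set (f l) = {}"
      for f :: "nat \<Rightarrow> real vec list" and ks
      using that by (induction ks) fastforce+
    note gen = this
    have "set (bs (\<iota> k)) \<inter> set (bs (\<iota> l)) = {}" if "k < 2 ^ t" "l < 2 ^ t" "k \<noteq> l" for k l
    proof (rule disj)
      show "\<iota> k \<in> Z2_power t" "\<iota> l \<in> Z2_power t" "\<iota> k \<noteq> \<iota> l"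
        using that im inj by (auto simp: inj_on_def)
    qed
    then show ?thesis unfolding Xs_def by (intro gen) (use bs(1) in auto)
  qed
  moreover have "R.basis (set (concat Xs))"
    unfolding R.basis_def
  proof (intro conjI)
    show "R.lin_indpt (set (concat Xs))"
      unfolding set by (rule lin_indpt_Union_isotypic) (use bas in auto)
    show "set (concat Xs) \<subseteq> carrier_vec n" by (rule car)
    have "x \<in> R.span (set (concat Xs))" if x: "x \<in> carrier_vec n" for x
    proof -
      \<comment> \<open>Each projection of x lies in the span of one of the lists, and together they
        add up to x.\<close>
      let ?ps = "map (\<lambda>k. isotypic_proj (\<iota> k) x) [0..<2 ^ t]"
      have ps: "set ?ps \<subseteq> carrier_vec n" by (auto simp: isotypic_proj_def)
      have "R.sumlist ?ps \<in> R.span (set (concat Xs))"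
      proof (rule R.sumlist_in_span[OF car])
        fix y assume "y \<in> set ?ps"
        then obtain i where "i < 2 ^ t" "y = isotypic_proj (\<iota> i) x" by auto
        then obtain \<kappa> where k: "\<kappa> \<in> Z2_power t" "y = isotypic_proj \<kappa> x" using im by blast
        then have "y \<in> R.span (set (bs \<kappa>))" using isotypic_proj_in[OF x] bas(3) by simp
        then show "y \<in> R.span (set (concat Xs))"
          using R.span_is_monotone[of "set (bs \<kappa>)" "set (concat Xs)"] k(1) set by blast
      qed
      moreover have "R.sumlist ?ps = x"
      proof (rule eq_vecI)
        show "dim_vec (R.sumlist ?ps) = dim_vec x"
          using x R.sumlist_dim[of ?ps] ps by auto
        fix i assume "i < dim_vec x"
        then have i: "i < n" using x by simp
        have "R.sumlist ?ps $ i = (\<Sum>j = 0..<2 ^ t. isotypic_proj (\<iota> j) x $ i)"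
          by (subst R.sumlist_nth) (use ps i in auto)
        also have "\<dots> = (\<Sum>\<kappa>\<in>Z2_power t. isotypic_proj \<kappa> x $ i)"
          using sum.reindex_bij_betw[OF \<iota>, of "\<lambda>\<kappa>. isotypic_proj \<kappa> x $ i"] by (simp add: lessThan_atLeast0)
        finally show "R.sumlist ?ps $ i = x $ i" using isotypic_proj_sum[OF x i] by simp
      qed
      ultimately show ?thesis by simp
    qed
    then show "R.span (set (concat Xs)) = carrier_vec n"
      using R.span_is_subset2[of "set (concat Xs)"] car by auto
  qed
  ultimately have "length (concat Xs) = n" "invertible_mat (mat_of_cols n (concat Xs))"
    using R.invertible_mat_of_basis by blast+
  moreover have "length Xs = 2 ^ t" "Xs ! k = bs (\<iota> k)" if "k < 2 ^ t" for k
    using that by (auto simp: Xs_def)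
  moreover have "is_basis_of n (bs \<kappa>) (isotypic \<kappa>)" for \<kappa>
    using bs[of \<kappa>] by (simp add: is_basis_of_def)
  ultimately show thesis using that[of Xs] bas(1) by (simp add: Xs_def)
qed

end

section \<open>Block diagonalisation of an intertwiner\<close>

lemma intertwiner_isotypic:
  assumes P: "Z2_representation t n P" and Q: "Z2_representation t m Q"
    and R: "R \<in> carrier_mat m n"
    and comm: "\<And>\<gamma>. \<gamma> \<in> Z2_power t \<Longrightarrow> Q \<gamma> * R = R * P \<gamma>"
    and x: "x \<in> isotypic_subspace t n P \<rho>"
  shows "R *\<^sub>v x \<in> isotypic_subspace t m Q \<rho>"
proof -
  have xc: "x \<in> carrier_vec n" using x by (simp add: isotypic_subspace_def)
  have "Q \<gamma> *\<^sub>v (R *\<^sub>v x) = \<rho> \<gamma> \<cdot>\<^sub>v (R *\<^sub>v x)" if g: "\<gamma> \<in> Z2_power t" for \<gamma>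
  proof -
    note Pc = Z2_representation.P_carrier[OF P g] and Qc = Z2_representation.P_carrier[OF Q g]
    have "Q \<gamma> *\<^sub>v (R *\<^sub>v x) = R *\<^sub>v (P \<gamma> *\<^sub>v x)"
      unfolding assoc_mult_mat_vec[OF Qc R xc, symmetric] comm[OF g] assoc_mult_mat_vec[OF R Pc xc] ..
    also have "P \<gamma> *\<^sub>v x = \<rho> \<gamma> \<cdot>\<^sub>v x" using x g by (simp add: isotypic_subspace_def)
    finally show ?thesis by (simp add: mult_mat_vec[OF R xc])
  qed
  then show ?thesis using mult_mat_vec_carrier[OF R xc] by (simp add: isotypic_subspace_def)
qed

section \<open>Products with concatenated bases and the positions of their blocks\<close>

lemma mat_of_cols_sandwich:
  assumes R: "R \<in> carrier_mat m n"
    and ys: "set ys \<subseteq> carrier_vec m" and xs: "set xs \<subseteq> carrier_vec n"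
  shows "transpose_mat (mat_of_cols m ys) * R * mat_of_cols n xs
    = mat (length ys) (length xs) (\<lambda>(i, j). ys ! i \<bullet> (R *\<^sub>v xs ! j))"
proof (rule eq_matI)
  fix i j assume "i < dim_row (mat (length ys) (length xs) (\<lambda>(i, j). ys ! i \<bullet> (R *\<^sub>v xs ! j)))"
    "j < dim_col (mat (length ys) (length xs) (\<lambda>(i, j). ys ! i \<bullet> (R *\<^sub>v xs ! j)))"
  then have i: "i < length ys" and j: "j < length xs" by auto
  have yc: "ys ! i \<in> carrier_vec m" and xc: "xs ! j \<in> carrier_vec n"
    using i j ys xs by (auto simp: subset_iff)
  have C: "mat_of_cols m ys \<in> carrier_mat m (length ys)" by simp
  have "transpose_mat (mat_of_cols m ys) * R * mat_of_cols n xs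
      = transpose_mat (mat_of_cols m ys) * (R * mat_of_cols n xs)"
    by (rule assoc_mult_mat[OF _ R]) auto
  then show "(transpose_mat (mat_of_cols m ys) * R * mat_of_cols n xs) $$ (i, j)
      = mat (length ys) (length xs) (\<lambda>(i, j). ys ! i \<bullet> (R *\<^sub>v xs ! j)) $$ (i, j)"
    using i j R yc xc by (simp add: col_mult2[OF R, of _ "length xs"])
qed auto

text \<open>Splitting off the first pair of lists leaves a two-by-two block matrix whose mixed
  blocks vanish by \<open>zero\<close>; induction handles the remaining corner. Empty lists are
  covered without a separate case.\<close>

lemma mat_of_cols_sandwich_diag:
  fixes R :: "'a :: comm_ring_1 mat"
  assumes R: "R \<in> carrier_mat m n" and len: "length Ys = length Xs"
    and Ys: "\<And>ys. ys \<in> set Ys \<Longrightarrow> set ys \<subseteq> carrier_vec m"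
    and Xs: "\<And>xs. xs \<in> set Xs \<Longrightarrow> set xs \<subseteq> carrier_vec n"
    and zero: "\<And>k l x y. k < length Xs \<Longrightarrow> l < length Xs \<Longrightarrow> k \<noteq> l \<Longrightarrow>
      y \<in> set (Ys ! k) \<Longrightarrow> x \<in> set (Xs ! l) \<Longrightarrow> y \<bullet> (R *\<^sub>v x) = 0"
  shows "transpose_mat (mat_of_cols m (concat Ys)) * R * mat_of_cols n (concat Xs)
    = diag_block_mat (map2 (\<lambda>ys xs. transpose_mat (mat_of_cols m ys) * R * mat_of_cols n xs) Ys Xs)"
  using len Ys Xs zero
proof (induction Ys Xs rule: list_induct2)
  case Nil
  then show ?case by (intro eq_matI) auto
next
  case (Cons ys Ys xs Xs)
  let ?M = "\<lambda>ys xs. transpose_mat (mat_of_cols m ys) * R * mat_of_cols n xs"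
  have IH: "?M (concat Ys) (concat Xs) = diag_block_mat (map2 ?M Ys Xs)"
  proof (rule Cons.IH)
    fix k l x y assume "k < length Xs" "l < length Xs" "k \<noteq> l" "y \<in> set (Ys ! k)" "x \<in> set (Xs ! l)"
    then show "y \<bullet> (R *\<^sub>v x) = 0" using Cons.prems(3)[of "Suc k" "Suc l"] by simp
  qed (use Cons.prems in auto)
  have car: "set ys \<subseteq> carrier_vec m" "set (concat Ys) \<subseteq> carrier_vec m"
    "set xs \<subseteq> carrier_vec n" "set (concat Xs) \<subseteq> carrier_vec n"
    using Cons.prems(1,2) by auto
  have z1: "ys ! i \<bullet> (R *\<^sub>v concat Xs ! j) = 0" if "i < length ys" "j < length (concat Xs)" for i j
  proof -
    have mem: "concat Xs ! j \<in> set (concat Xs)" using that(2) by (rule nth_mem)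
    obtain l where l: "l < length Xs" "concat Xs ! j \<in> set (Xs ! l)"
      using mem unfolding set_concat UN_iff by (metis in_set_conv_nth)
    then show ?thesis using Cons.prems(3)[of 0 "Suc l"] that(1) by simp
  qed
  have z2: "concat Ys ! i \<bullet> (R *\<^sub>v xs ! j) = 0" if "i < length (concat Ys)" "j < length xs" for i j
  proof -
    have mem: "concat Ys ! i \<in> set (concat Ys)" using that(1) by (rule nth_mem)
    obtain l where l: "l < length Ys" "concat Ys ! i \<in> set (Ys ! l)"
      using mem unfolding set_concat UN_iff by (metis in_set_conv_nth)
    then show ?thesis using Cons.prems(3)[of "Suc l" 0] that(2) Cons.hyps by simp
  qed
  have "?M (concat (ys # Ys)) (concat (xs # Xs))
    = four_block_mat (?M ys xs) (0\<^sub>m (length ys) (length (concat Xs)))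
        (0\<^sub>m (length (concat Ys)) (length xs)) (?M (concat Ys) (concat Xs))"
    using car by (intro eq_matI) (auto simp: mat_of_cols_sandwich[OF R] nth_append z1 z2)
  \<comment> \<open>Folding \<open>IH\<close> back allows the sizes of the zero blocks to be read
    off from the concatenated lists.\<close>
  then show ?case
    unfolding IH by (simp add: Let_def flip: IH)
qed

lemma nth_concat_block:
  assumes "k < length Xs"
  shows "map ((!) (concat Xs)) [length (concat (take k Xs))..<length (concat (take k Xs)) + length (Xs ! k)] = Xs ! k"
proof -
  have "concat Xs = concat (take k Xs) @ Xs ! k @ concat (drop (Suc k) Xs)"
    using id_take_nth_drop[OF assms] by (metis concat.simps(2) concat_append)
  then show ?thesis
    by (intro nth_equalityI) (auto simp: nth_append)
qed

text \<open>The offset of a block adds up the widths of the earlier blocks, so it is also the offset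
  in \<open>concat Xs\<close> as soon as widths and list lengths agree.\<close>

lemma block_columns_eq:
  assumes A: "A = mat_of_cols n (concat Xs)" and Xs: "\<And>xs. xs \<in> set Xs \<Longrightarrow> set xs \<subseteq> carrier_vec n"
    and Rs: "map dim_col Rs = map length Xs" and k: "k < length Xs"
  shows "block_columns Rs k A = Xs ! k"
proof -
  have len: "length Rs = length Xs" using Rs by (rule map_eq_imp_length_eq)
  have k0: "sum_list (map dim_col (take k Rs)) = length (concat (take k Xs))"
    using Rs by (simp add: length_concat flip: take_map)
  have dk: "dim_col (Rs ! k) = length (Xs ! k)"
    using k len by (metis Rs nth_map)
  let ?k = "length (concat (take k Xs))"
  have le: "?k + length (Xs ! k) \<le> length (concat Xs)"
    using k by (subst (2) id_take_nth_drop[OF k]) simp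
  have "map (col A) [?k..<?k + length (Xs ! k)] = map ((!) (concat Xs)) [?k..<?k + length (Xs ! k)]"
  proof (rule map_cong[OF refl])
    fix i assume "i \<in> set [?k..<?k + length (Xs ! k)]"
    then have "i < length (concat Xs)" using le by simp
    then show "col A i = concat Xs ! i"
      unfolding A using Xs nth_mem[of i "concat Xs"] by (intro col_mat_of_cols) auto
  qed
  then show ?thesis
    unfolding block_columns_def Let_def k0 dk using nth_concat_block[OF k] by simp
qed

text \<open>Transposing the blocks lets the result on columns of A serve for B as well.\<close>

lemma block_rows_eq_block_columns:
  "block_rows Rs k B = block_columns (map transpose_mat Rs) k B" if "k < length Rs"
  using that by (simp add: block_rows_def block_columns_def take_map comp_def)

lemma intertwiner_block_diagonal:
  assumes P: "Z2_representation t n P" and Q: "Z2_representation t m Q"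
    and R: "R \<in> carrier_mat m n"
    and comm: "\<And>\<gamma>. \<gamma> \<in> Z2_power t \<Longrightarrow> Q \<gamma> * R = R * P \<gamma>"
    and \<iota>: "bij_betw \<iota> {..<2 ^ t :: nat} (Z2_power t)"
  shows "\<exists>A B Rs. A \<in> carrier_mat n n \<and> invertible_mat A \<and>
    B \<in> carrier_mat m m \<and> invertible_mat B \<and> length Rs = 2 ^ t \<and>
    transpose_mat B * R * A = diag_block_mat Rs \<and>
    (\<forall>\<kappa><2 ^ t.
       is_basis_of n (block_columns Rs \<kappa> A) (isotypic_subspace t n P (irrep t (\<iota> \<kappa>))) \<and>
       is_basis_of m (block_rows Rs \<kappa> B) (isotypic_subspace t m Q (irrep t (\<iota> \<kappa>))))"
proof -
  interpret P: Z2_representation t n P by (rule P)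
  interpret Q: Z2_representation t m Q by (rule Q)
  obtain Xs where lX: "length Xs = 2 ^ t"
    and bX: "\<And>\<kappa>. \<kappa> < 2 ^ t \<Longrightarrow> is_basis_of n (Xs ! \<kappa>) (P.isotypic (\<iota> \<kappa>))"
    and sX: "\<And>\<kappa>. \<kappa> < 2 ^ t \<Longrightarrow> set (Xs ! \<kappa>) \<subseteq> P.isotypic (\<iota> \<kappa>)"
    and nX: "length (concat Xs) = n" and iX: "invertible_mat (mat_of_cols n (concat Xs))"
    using P.isotypic_bases[OF \<iota>] by blast
  obtain Ys where lY: "length Ys = 2 ^ t"
    and bY: "\<And>\<kappa>. \<kappa> < 2 ^ t \<Longrightarrow> is_basis_of m (Ys ! \<kappa>) (Q.isotypic (\<iota> \<kappa>))"
    and sY: "\<And>\<kappa>. \<kappa> < 2 ^ t \<Longrightarrow> set (Ys ! \<kappa>) \<subseteq> Q.isotypic (\<iota> \<kappa>)"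
    and nY: "length (concat Ys) = m" and iY: "invertible_mat (mat_of_cols m (concat Ys))"
    using Q.isotypic_bases[OF \<iota>] by blast
  define A where "A = mat_of_cols n (concat Xs)"
  define B where "B = mat_of_cols m (concat Ys)"
  define Rs where "Rs = map2 (\<lambda>ys xs. transpose_mat (mat_of_cols m ys) * R * mat_of_cols n xs) Ys Xs"
  have cX: "set xs \<subseteq> carrier_vec n" if "xs \<in> set Xs" for xs
    using that sX lX P.isotypicD(1) by (metis in_set_conv_nth subset_iff)
  have cY: "set ys \<subseteq> carrier_vec m" if "ys \<in> set Ys" for ys
    using that sY lY Q.isotypicD(1) by (metis in_set_conv_nth subset_iff)
  have "transpose_mat B * R * A = diag_block_mat Rs"
    unfolding A_def B_def Rs_def
  proof (rule mat_of_cols_sandwich_diag[OF R _ cY cX])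
    show "length Ys = length Xs" using lX lY by simp
    fix k l x y
    assume kl: "k < length Xs" "l < length Xs" "k \<noteq> l" and y: "y \<in> set (Ys ! k)" and x: "x \<in> set (Xs ! l)"
    \<comment> \<open>Injectivity of the enumeration turns different block numbers into different
      characters.\<close>
    have "\<iota> k \<noteq> \<iota> l" "\<iota> k \<in> Z2_power t" "\<iota> l \<in> Z2_power t"
      using \<iota> kl lX by (auto simp: bij_betw_def inj_on_def)
    moreover have "y \<in> Q.isotypic (\<iota> k)" using sY[of k] y kl lX by auto
    moreover have "R *\<^sub>v x \<in> Q.isotypic (\<iota> l)"
      using sX[of l] x kl lX by (intro intertwiner_isotypic[OF P Q R comm]) auto
    ultimately show "y \<bullet> (R *\<^sub>v x) = 0" using Q.isotypic_orthogonal by blast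
  qed
  moreover have "A \<in> carrier_mat n n" "B \<in> carrier_mat m m"
    unfolding A_def B_def using mat_of_cols_carrier(1)[of n "concat Xs"] mat_of_cols_carrier(1)[of m "concat Ys"]
    unfolding nX nY by auto
  moreover have lR: "length Rs = 2 ^ t" by (simp add: Rs_def lX lY)
  moreover have "block_columns Rs \<kappa> A = Xs ! \<kappa>" if "\<kappa> < 2 ^ t" for \<kappa>
    by (rule block_columns_eq[OF A_def cX]) (use that lX lY in \<open>auto simp: Rs_def intro!: nth_equalityI\<close>)
  moreover have "block_rows Rs \<kappa> B = Ys ! \<kappa>" if k: "\<kappa> < 2 ^ t" for \<kappa>
    unfolding block_rows_eq_block_columns[OF k[folded lR]]
    by (rule block_columns_eq[OF B_def cY]) (use that lX lY in \<open>auto simp: Rs_def intro!: nth_equalityI\<close>)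
  ultimately show ?thesis
    using iX iY bX bY unfolding A_def[symmetric] B_def[symmetric]
    by (intro exI[of _ A] exI[of _ B] exI[of _ Rs]) simp
qed

section \<open>Signed permutation representations\<close>

lemma Z2_representation_cong:
  assumes "Z2_representation t n P" and "\<And>\<gamma>. \<gamma> \<in> Z2_power t \<Longrightarrow> Q \<gamma> = P \<gamma>"
  shows "Z2_representation t n Q"
  using assms by (simp add: Z2_representation_def)

text \<open>\<open>s_add\<close> is the cocycle condition that makes the signed permutation matrices
  multiplicative; \<open>s_act\<close> makes them symmetric, because an involution places its
  nonzero entries symmetrically. The map \<open>lab\<close> numbers the points.\<close>

locale signed_action =
  fixes t n :: nat and lab :: "nat \<Rightarrow> 'x" and X :: "'x set"
    and act :: "bit vec \<Rightarrow> 'x \<Rightarrow> 'x" and s :: "bit vec \<Rightarrow> 'x \<Rightarrow> real"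
  assumes lab: "bij_betw lab {..<n} X"
    and act_closed: "\<gamma> \<in> Z2_power t \<Longrightarrow> x \<in> X \<Longrightarrow> act \<gamma> x \<in> X"
    and act_add: "\<gamma> \<in> Z2_power t \<Longrightarrow> \<delta> \<in> Z2_power t \<Longrightarrow> x \<in> X \<Longrightarrow> act (\<gamma> + \<delta>) x = act \<gamma> (act \<delta> x)"
    and act_zero: "x \<in> X \<Longrightarrow> act (0\<^sub>v t) x = x"
    and s_add: "\<gamma> \<in> Z2_power t \<Longrightarrow> \<delta> \<in> Z2_power t \<Longrightarrow> x \<in> X \<Longrightarrow> s (\<gamma> + \<delta>) x = s \<gamma> (act \<delta> x) * s \<delta> x"
    and s_zero: "x \<in> X \<Longrightarrow> s (0\<^sub>v t) x = 1"
    and s_act: "\<gamma> \<in> Z2_power t \<Longrightarrow> x \<in> X \<Longrightarrow> s \<gamma> (act \<gamma> x) = s \<gamma> x"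
begin

definition rep :: "bit vec \<Rightarrow> real mat" where
  "rep \<gamma> = mat n n (\<lambda>(k, l). if lab k = act \<gamma> (lab l) then s \<gamma> (lab l) else 0)"

lemma act_act: "\<gamma> \<in> Z2_power t \<Longrightarrow> x \<in> X \<Longrightarrow> act \<gamma> (act \<gamma> x) = x"
  using act_add[of \<gamma> \<gamma> x] by (simp add: act_zero)

lemma act_eq_iff:
  assumes "\<gamma> \<in> Z2_power t" "x \<in> X" "y \<in> X"
  shows "x = act \<gamma> y \<longleftrightarrow> y = act \<gamma> x"
  using assms act_act by metis

lemma lab_in: "k < n \<Longrightarrow> lab k \<in> X"
  using lab by (auto simp: bij_betw_def)

lemma lab_eq_iff: "k < n \<Longrightarrow> l < n \<Longrightarrow> lab k = lab l \<longleftrightarrow> k = l"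
  using lab by (auto simp: bij_betw_def inj_on_def)

lemma sum_lab:
  assumes "y \<in> X"
  shows "(\<Sum>k<n. if lab k = y then g (lab k) else (0 :: real)) = g y"
proof -
  have "finite X" using lab bij_betw_finite by blast
  have "(\<Sum>k<n. if lab k = y then g (lab k) else 0) = (\<Sum>x\<in>X. if x = y then g x else 0)"
    using sum.reindex_bij_betw[OF lab, of "\<lambda>x. if x = y then g x else 0"] .
  also have "\<dots> = g y" using \<open>finite X\<close> assms by simp
  finally show ?thesis .
qed

lemma Z2_representation_rep: "Z2_representation t n rep"
proof
  fix \<gamma> assume g: "\<gamma> \<in> Z2_power t"
  show "rep \<gamma> \<in> carrier_mat n n" by (simp add: rep_def)
  show "transpose_mat (rep \<gamma>) = rep \<gamma>"
  proof (rule eq_matI)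
    fix k l assume "k < dim_row (rep \<gamma>)" "l < dim_col (rep \<gamma>)"
    then have kl: "k < n" "l < n" by (auto simp: rep_def)
    then show "transpose_mat (rep \<gamma>) $$ (k, l) = rep \<gamma> $$ (k, l)"
      using act_eq_iff[OF g lab_in[OF kl(1)] lab_in[OF kl(2)]] s_act[OF g lab_in[OF kl(1)]]
      by (auto simp: rep_def)
  qed (simp_all add: rep_def)
  fix \<delta> assume d: "\<delta> \<in> Z2_power t"
  show "rep (\<gamma> + \<delta>) = rep \<gamma> * rep \<delta>"
  proof (rule eq_matI)
    fix k m assume "k < dim_row (rep \<gamma> * rep \<delta>)" "m < dim_col (rep \<gamma> * rep \<delta>)"
    then have km: "k < n" "m < n" by (auto simp: rep_def)
    let ?x = "lab m"
    have x: "?x \<in> X" "act \<delta> ?x \<in> X" using lab_in[OF km(2)] act_closed[OF d] by auto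
    \<comment> \<open>In the sum over the intermediate index only the one labelled
      \<open>act \<delta> ?x\<close> survives.\<close>
    have "(rep \<gamma> * rep \<delta>) $$ (k, m)
      = (\<Sum>l<n. if lab l = act \<delta> ?x
          then (if lab k = act \<gamma> (lab l) then s \<gamma> (lab l) else 0) * s \<delta> ?x else 0)"
      using km by (auto simp: rep_def scalar_prod_def lessThan_atLeast0 intro!: sum.cong)
    also have "\<dots> = (if lab k = act \<gamma> (act \<delta> ?x) then s \<gamma> (act \<delta> ?x) else 0) * s \<delta> ?x"
      by (rule sum_lab[OF x(2)])
    finally show "rep (\<gamma> + \<delta>) $$ (k, m) = (rep \<gamma> * rep \<delta>) $$ (k, m)"
      using km by (simp add: rep_def act_add[OF g d x(1)] s_add[OF g d x(1)])
  qed (simp_all add: rep_def)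
next
  show "rep (0\<^sub>v t) = 1\<^sub>m n"
    by (intro eq_matI) (auto simp: rep_def act_zero s_zero lab_in lab_eq_iff)
qed

end

text \<open>Each row or column of a signed permutation matrix has one nonzero entry, so both
  products collapse to a single value of \<open>f\<close>, and the equivariance of \<open>f\<close>
  compares the two.\<close>

lemma signed_action_intertwiner:
  fixes f :: "'y \<Rightarrow> 'x \<Rightarrow> real"
  assumes "signed_action t n labX X actX sX" and "signed_action t m labY Y actY sY"
    and f: "\<And>\<gamma> x y. \<gamma> \<in> Z2_power t \<Longrightarrow> x \<in> X \<Longrightarrow> y \<in> Y \<Longrightarrow>
      sY \<gamma> y * f (actY \<gamma> y) (actX \<gamma> x) = f y x * sX \<gamma> x"
    and g: "\<gamma> \<in> Z2_power t"
  defines "R \<equiv> mat m n (\<lambda>(a, k). f (labY a) (labX k))"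
  shows "signed_action.rep m labY actY sY \<gamma> * R = R * signed_action.rep n labX actX sX \<gamma>"
proof -
  interpret X: signed_action t n labX X actX sX by fact
  interpret Y: signed_action t m labY Y actY sY by fact
  show ?thesis
  proof (rule eq_matI)
    fix a k assume "a < dim_row (R * X.rep \<gamma>)" "k < dim_col (R * X.rep \<gamma>)"
    then have a: "a < m" and k: "k < n" by (auto simp: R_def X.rep_def)
    note x = X.lab_in[OF k] and y = Y.lab_in[OF a]
    have gx: "actX \<gamma> (labX k) \<in> X" and gy: "actY \<gamma> (labY a) \<in> Y"
      using X.act_closed[OF g x] Y.act_closed[OF g y] .
    have "(Y.rep \<gamma> * R) $$ (a, k)
        = (\<Sum>b<m. (if labY a = actY \<gamma> (labY b) then sY \<gamma> (labY b) else 0) * f (labY b) (labX k))"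
      using a k by (auto simp: R_def Y.rep_def scalar_prod_def lessThan_atLeast0 intro!: sum.cong)
    also have "\<dots> = (\<Sum>b<m. if labY b = actY \<gamma> (labY a) then sY \<gamma> (labY b) * f (labY b) (labX k) else 0)"
      using Y.act_eq_iff[OF g y Y.lab_in] by (intro sum.cong) auto
    also have "\<dots> = sY \<gamma> (labY a) * f (actY \<gamma> (labY a)) (labX k)"
      by (subst Y.sum_lab[OF gy]) (simp add: Y.s_act[OF g y])
    \<comment> \<open>Equivariance is applied at the translated point; acting twice with \<gamma>
      returns to \<open>labX k\<close>, and the sign is the same at both points.\<close>
    also have "\<dots> = f (labY a) (actX \<gamma> (labX k)) * sX \<gamma> (labX k)"
      using f[OF g gx y] by (simp add: X.act_act[OF g x] X.s_act[OF g x])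
    also have "\<dots> = (\<Sum>l<n. if labX l = actX \<gamma> (labX k) then f (labY a) (labX l) * sX \<gamma> (labX k) else 0)"
      by (rule X.sum_lab[OF gx, symmetric])
    also have "\<dots> = (R * X.rep \<gamma>) $$ (a, k)"
      using a k by (auto simp: R_def X.rep_def scalar_prod_def lessThan_atLeast0 intro!: sum.cong)
    finally show "(Y.rep \<gamma> * R) $$ (a, k) = (R * X.rep \<gamma>) $$ (a, k)" .
  qed (auto simp: R_def X.rep_def Y.rep_def)
qed

section \<open>The extrusion action on vertices and the external representation\<close>

lemma extr_act_closed:
  "\<gamma> \<in> Z2_power t \<Longrightarrow> i \<in> extr_verts t V \<Longrightarrow> extr_act \<gamma> i \<in> extr_verts t V"
  by (auto simp: extr_verts_def extr_act_def)

lemma extr_act_add: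
  "\<gamma> \<in> Z2_power t \<Longrightarrow> \<delta> \<in> Z2_power t \<Longrightarrow> i \<in> extr_verts t V \<Longrightarrow>
    extr_act (\<gamma> + \<delta>) i = extr_act \<gamma> (extr_act \<delta> i)"
  by (auto simp: extr_verts_def extr_act_def Z2_power_def comm_add_vec[of \<gamma> t \<delta>])

lemma extr_act_zero: "i \<in> extr_verts t V \<Longrightarrow> extr_act (0\<^sub>v t) i = i"
  by (auto simp: extr_verts_def extr_act_def Z2_power_def)

lemma external_rep_signed_action:
  assumes "distinct vs" "set vs = extr_verts t V"
  shows "signed_action t (d * length vs) (\<lambda>k. (vs ! (k div d), k mod d)) (extr_verts t V \<times> {..<d})
    (\<lambda>\<gamma> (i, c). (extr_act \<gamma> i, c)) (\<lambda>_ _. 1)"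
proof
  \<comment> \<open>For d = 0 there is no such k; the case split is needed because
    \<open>k mod d < d\<close> fails there.\<close>
  have lt: "k div d < length vs" "k mod d < d" if "k < d * length vs" for k
    using that by (cases "d = 0"; simp add: less_mult_imp_div_less mult.commute)+
  have "inj_on (\<lambda>k. (vs ! (k div d), k mod d)) {..<d * length vs}"
  proof (rule inj_onI)
    fix k l assume "k \<in> {..<d * length vs}" "l \<in> {..<d * length vs}"
      "(vs ! (k div d), k mod d) = (vs ! (l div d), l mod d)"
    then have "k div d = l div d" "k mod d = l mod d"
      using lt nth_eq_iff_index_eq[OF assms(1)] by auto
    then show "k = l" by (metis div_mult_mod_eq)
  qed
  moreover have "(\<lambda>k. (vs ! (k div d), k mod d)) ` {..<d * length vs} = extr_verts t V \<times> {..<d}"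
  proof (intro equalityI subsetI)
    fix x assume "x \<in> extr_verts t V \<times> {..<d}"
    then obtain v c where v: "x = (v, c)" "v \<in> set vs" "c < d"
      unfolding assms(2)[symmetric] by blast
    then obtain i where x: "x = (vs ! i, c)" "i < length vs" "c < d"
      by (metis in_set_conv_nth)
    have "d * i + c < d * Suc i" using x(3) by simp
    also have "\<dots> \<le> d * length vs" using x(2) by (intro mult_le_mono2) simp
    finally show "x \<in> (\<lambda>k. (vs ! (k div d), k mod d)) ` {..<d * length vs}"
      using x by (intro image_eqI[of _ _ "d * i + c"]) auto
  qed (use lt assms(2) in auto)
  ultimately show "bij_betw (\<lambda>k. (vs ! (k div d), k mod d)) {..<d * length vs} (extr_verts t V \<times> {..<d})"
    by (simp add: bij_betw_def)
qed (auto simp: extr_act_closed extr_act_add extr_act_zero)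

text \<open>The identity factor of the Kronecker product vanishes unless the coordinates agree,
  which matches an action that moves the vertex and fixes the coordinate.\<close>

lemma external_rep_eq_rep:
  assumes "distinct vs" "set vs = extr_verts t V"
  shows "external_rep d vs \<gamma> = signed_action.rep (d * length vs) (\<lambda>k. (vs ! (k div d), k mod d))
    (\<lambda>\<gamma> (i, c). (extr_act \<gamma> i, c)) (\<lambda>_ _. 1) \<gamma>"
proof -
  have lt: "k div d < length vs" "k mod d < d" if "k < d * length vs" for k
    using that by (cases "d = 0"; simp add: less_mult_imp_div_less mult.commute)+
  show ?thesis
    unfolding signed_action.rep_def[OF external_rep_signed_action[OF assms]] external_rep_def
      kronecker_product_def vert_perm_mat_def
    by (rule eq_matI) (auto simp: lt mult.commute)
qed

section \<open>Edges and the rigidity matrix\<close>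

text \<open>The cocycle of the internal representation: on a fibre edge in direction h it is -1 to
  the power of the h-th bit of \<gamma>, and on a copy of an edge of H it is 1.\<close>

definition edge_sign :: "nat \<Rightarrow> bit vec \<Rightarrow> ('a \<times> bit vec) set \<Rightarrow> real" where
  "edge_sign t \<gamma> f = (if reversed_edge t \<gamma> f then - 1 else 1)"

lemma differ_only_at_sym: "differ_only_at t h e e' \<Longrightarrow> differ_only_at t h e' e"
  by (auto simp: differ_only_at_def)

lemma differ_only_at_unique: "differ_only_at t h e e' \<Longrightarrow> differ_only_at t k e e' \<Longrightarrow> h = k"
  by (auto simp: differ_only_at_def)

lemma differ_only_at_add:
  assumes "\<gamma> \<in> Z2_power t" "e \<in> Z2_power t" "e' \<in> Z2_power t" "differ_only_at t h e e'"
  shows "differ_only_at t h (e + \<gamma>) (e' + \<gamma>)"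
proof -
  have "x + z \<noteq> y + z \<longleftrightarrow> x \<noteq> y" for x y z :: bit by (cases x; cases y; cases z) simp_all
  then show ?thesis using assms unfolding differ_only_at_def Z2_power_def by (auto simp del: bit_not_one_iff bit_not_zero_iff)
qed

lemma extr_edgeE:
  assumes "fin_simple_graph V E" "f \<in> extr_edges t V E"
  obtains (base) v w e where "f = {(v, e), (w, e)}" "v \<noteq> w" "{v, w} \<in> E" "v \<in> V" "w \<in> V" "e \<in> Z2_power t"
  | (fibre) v e e' h where "f = {(v, e), (v, e')}" "v \<in> V" "e \<in> Z2_power t" "e' \<in> Z2_power t"
      "differ_only_at t h e e'" "e \<noteq> e'"
proof -
  have E: "v \<noteq> w \<and> v \<in> V \<and> w \<in> V" if "{v, w} \<in> E" for v w
    using assms(1) that unfolding fin_simple_graph_def by (cases "v = w") force+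
  have ne: "e \<noteq> e'" if "differ_only_at t h e e'" for h e e'
    using that by (auto simp: differ_only_at_def)
  show thesis
    using assms(2) unfolding extr_edges_def
  proof (elim UnE CollectE exE conjE)
    fix v w e assume "f = {(v, e), (w, e)}" "{v, w} \<in> E" "e \<in> Z2_power t"
    then show thesis using base E by blast
  next
    fix v e e' h
    assume "f = {(v, e), (v, e')}" "v \<in> V" "e \<in> Z2_power t" "e' \<in> Z2_power t" "differ_only_at t h e e'"
    then show thesis using fibre ne by blast
  qed
qed

lemma extr_edge_subset:
  assumes "fin_simple_graph V E" "f \<in> extr_edges t V E"
  shows "f \<subseteq> extr_verts t V"
  using assms by (cases rule: extr_edgeE) (auto simp: extr_verts_def)

lemma reversed_edge_base:
  "v \<noteq> w \<Longrightarrow> \<not> reversed_edge t \<gamma> {(v, e), (w, e)}"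
  unfolding reversed_edge_def by (auto simp: doubleton_eq_iff)

text \<open>The direction h is determined by the unordered pair, because
  \<open>differ_only_at\<close> is symmetric and its position is unique; the choices hidden in
  \<open>reversed_edge\<close> are harmless.\<close>

lemma reversed_edge_fibre:
  assumes "e \<in> Z2_power t" "e' \<in> Z2_power t" "differ_only_at t h e e'"
  shows "reversed_edge t \<gamma> {(v, e), (v, e')} \<longleftrightarrow> \<gamma> $ h = 1"
proof
  assume "reversed_edge t \<gamma> {(v, e), (v, e')}"
  then obtain w a a' k where k: "{(v, e), (v, e')} = {(w, a), (w, a')}" "differ_only_at t k a a'" "\<gamma> $ k = 1"
    unfolding reversed_edge_def by blast
  then have "differ_only_at t k e e'"
    using differ_only_at_sym by (auto simp: doubleton_eq_iff)
  then show "\<gamma> $ h = 1" using differ_only_at_unique[OF assms(3)] k(3) by simp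
qed (use assms in \<open>auto simp: reversed_edge_def\<close>)

lemma extr_act_edge_doubleton [simp]:
  "extr_act_edge \<gamma> {i, j} = {extr_act \<gamma> i, extr_act \<gamma> j}"
  by (simp add: extr_act_edge_def)

lemma extr_act_edge_closed:
  assumes "fin_simple_graph V E" "\<gamma> \<in> Z2_power t" "f \<in> extr_edges t V E"
  shows "extr_act_edge \<gamma> f \<in> extr_edges t V E"
  using assms(1,3)
proof (cases rule: extr_edgeE)
  case (base v w e)
  then show ?thesis
    using assms(2) unfolding extr_edges_def by (auto simp: extr_act_def)
next
  case (fibre v e e' h)
  then have "differ_only_at t h (e + \<gamma>) (e' + \<gamma>)" using assms(2) differ_only_at_add by blast
  then show ?thesis
    using assms(2) fibre unfolding extr_edges_def by (auto simp: extr_act_def)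
qed

text \<open>Translation preserves both the kind of an edge and its direction.\<close>

lemma edge_sign_act:
  assumes "fin_simple_graph V E" "\<gamma> \<in> Z2_power t" "\<delta> \<in> Z2_power t" "f \<in> extr_edges t V E"
  shows "edge_sign t \<gamma> (extr_act_edge \<delta> f) = edge_sign t \<gamma> f"
  using assms(1,4)
proof (cases rule: extr_edgeE)
  case (base v w e)
  then show ?thesis by (simp add: edge_sign_def extr_act_def reversed_edge_base)
next
  case (fibre v e e' h)
  then show ?thesis
    using assms(3) differ_only_at_add[of \<delta> t e e' h]
    by (simp add: edge_sign_def extr_act_def reversed_edge_fibre[of _ t _ h])
qed

lemma edge_sign_add:
  assumes "fin_simple_graph V E" "\<gamma> \<in> Z2_power t" "\<delta> \<in> Z2_power t" "f \<in> extr_edges t V E"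
  shows "edge_sign t (\<gamma> + \<delta>) f = edge_sign t \<gamma> f * edge_sign t \<delta> f"
  using assms(1,4)
proof (cases rule: extr_edgeE)
  case (base v w e)
  then show ?thesis by (simp add: edge_sign_def reversed_edge_base)
next
  case (fibre v e e' h)
  have "h < t" using fibre(5) by (simp add: differ_only_at_def)
  then have "(\<gamma> + \<delta>) $ h = \<gamma> $ h + \<delta> $ h" using assms(2,3) by (simp add: Z2_power_def)
  then show ?thesis
    unfolding fibre(1) edge_sign_def reversed_edge_fibre[OF fibre(3-5)]
    by (cases "\<gamma> $ h"; cases "\<delta> $ h") simp_all
qed

lemma edge_sign_zero:
  assumes "fin_simple_graph V E" "f \<in> extr_edges t V E"
  shows "edge_sign t (0\<^sub>v t) f = 1"
  using assms
proof (cases rule: extr_edgeE)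
  case (base v w e)
  then show ?thesis by (simp add: edge_sign_def reversed_edge_base)
next
  case (fibre v e e' h)
  then have "h < t" by (simp add: differ_only_at_def)
  then show ?thesis unfolding fibre(1) edge_sign_def reversed_edge_fibre[OF fibre(3-5)] by simp
qed

lemma internal_rep_signed_action:
  assumes G: "fin_simple_graph V E" and es: "distinct es" "set es = extr_edges t V E"
  shows "signed_action t (length es) ((!) es) (extr_edges t V E) extr_act_edge (edge_sign t)"
proof
  show "bij_betw ((!) es) {..<length es} (extr_edges t V E)"
    using bij_betw_nth[OF es(1)] es(2) by simp
  fix f assume f: "f \<in> extr_edges t V E"
  have fv: "i \<in> extr_verts t V" if "i \<in> f" for i using extr_edge_subset[OF G f] that by blast
  show "extr_act_edge (0\<^sub>v t) f = f"
    unfolding extr_act_edge_def using extr_act_zero[OF fv] by (simp cong: image_cong)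
  show "edge_sign t (0\<^sub>v t) f = 1" using edge_sign_zero[OF G f] .
  fix \<gamma> assume g: "\<gamma> \<in> Z2_power t"
  show "extr_act_edge \<gamma> f \<in> extr_edges t V E" using extr_act_edge_closed[OF G g f] .
  show "edge_sign t \<gamma> (extr_act_edge \<gamma> f) = edge_sign t \<gamma> f" using edge_sign_act[OF G g g f] .
  fix \<delta> assume d: "\<delta> \<in> Z2_power t"
  show "extr_act_edge (\<gamma> + \<delta>) f = extr_act_edge \<gamma> (extr_act_edge \<delta> f)"
    unfolding extr_act_edge_def image_image using extr_act_add[OF g d fv] by (rule image_cong[OF refl])
  show "edge_sign t (\<gamma> + \<delta>) f = edge_sign t \<gamma> (extr_act_edge \<delta> f) * edge_sign t \<delta> f"
    using edge_sign_add[OF G g d f] edge_sign_act[OF G g d f] by simp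
qed

text \<open>The two ways in which an entry becomes -1 coincide: \<gamma> is an involution on edges,
  and an edge is reversed exactly when its image is.\<close>

lemma internal_rep_eq_rep:
  assumes G: "fin_simple_graph V E" and es: "distinct es" "set es = extr_edges t V E" and g: "\<gamma> \<in> Z2_power t"
  shows "internal_rep t es \<gamma> = signed_action.rep (length es) ((!) es) extr_act_edge (edge_sign t) \<gamma>"
proof -
  interpret A: signed_action t "length es" "(!) es" "extr_edges t V E" extr_act_edge "edge_sign t"
    using internal_rep_signed_action[OF G es] .
  show ?thesis
  proof (rule eq_matI)
    fix a b assume "a < dim_row (A.rep \<gamma>)" "b < dim_col (A.rep \<gamma>)"
    then have ab: "a < length es" "b < length es" by (auto simp: A.rep_def)
    note e = A.lab_in[OF ab(1)] A.lab_in[OF ab(2)]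
    have "edge_sign t \<gamma> (es ! a) = edge_sign t \<gamma> (es ! b)" if "es ! a = extr_act_edge \<gamma> (es ! b)"
      unfolding that by (rule A.s_act[OF g e(2)])
    then have rev: "reversed_edge t \<gamma> (es ! a) \<longleftrightarrow> reversed_edge t \<gamma> (es ! b)" if "es ! a = extr_act_edge \<gamma> (es ! b)"
      using that by (simp add: edge_sign_def split: if_splits)
    have collapse: "(if ra \<and> q \<or> rb \<and> r then - 1 else if r then 1 else 0) = (if r then if rb then - 1 else 1 else (0 :: real))"
      if "q \<longleftrightarrow> r" "r \<Longrightarrow> ra \<longleftrightarrow> rb" for ra rb q r
      using that by auto
    have "internal_rep t es \<gamma> $$ (a, b) =
        (if reversed_edge t \<gamma> (es ! a) \<and> es ! b = extr_act_edge \<gamma> (es ! a) \<or>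
            reversed_edge t \<gamma> (es ! b) \<and> es ! a = extr_act_edge \<gamma> (es ! b)
         then - 1 else if es ! a = extr_act_edge \<gamma> (es ! b) then 1 else 0)"
      using ab by (simp add: internal_rep_def edge_perm_mat_def)
    also have "\<dots> = (if es ! a = extr_act_edge \<gamma> (es ! b) then if reversed_edge t \<gamma> (es ! b) then - 1 else 1 else 0)"
      using A.act_eq_iff[OF g e(2,1)] rev by (rule collapse)
    finally show "internal_rep t es \<gamma> $$ (a, b) = A.rep \<gamma> $$ (a, b)"
      using ab by (simp add: A.rep_def edge_sign_def)
  qed (auto simp: internal_rep_def A.rep_def)
qed

section \<open>Edge vectors under translation and equivariance of the rigidity matrix\<close>

lemma extrusion_symmetric_component:
  assumes "extrusion_symmetric d t V p" and p: "\<And>i. i \<in> extr_verts t V \<Longrightarrow> p i \<in> carrier_vec d"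
  obtains T :: "nat \<Rightarrow> nat \<Rightarrow> real" where
    "\<And>v e \<gamma> c. v \<in> V \<Longrightarrow> e \<in> Z2_power t \<Longrightarrow> \<gamma> \<in> Z2_power t \<Longrightarrow> c < d \<Longrightarrow>
      p (v, e + \<gamma>) $ c = p (v, e) $ c + (\<Sum>h<t. if \<gamma> $ h = 1 then if e $ h = 0 then T c h else - T c h else 0)"
proof -
  obtain \<tau> :: "nat \<Rightarrow> real vec" where tau: "\<And>h. h < t \<Longrightarrow> \<tau> h \<in> carrier_vec d"
    and sym: "\<And>v e \<gamma>. v \<in> V \<Longrightarrow> e \<in> Z2_power t \<Longrightarrow> \<gamma> \<in> Z2_power t \<Longrightarrow>
        p (extr_act \<gamma> (v, e)) = p (v, e)
          + finsum_vec TYPE(real) d \<tau> {h. h < t \<and> e $ h = 0 \<and> \<gamma> $ h = 1}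
          - finsum_vec TYPE(real) d \<tau> {h. h < t \<and> e $ h = 1 \<and> \<gamma> $ h = 1}"
    using assms(1) unfolding extrusion_symmetric_def by blast
  show thesis
  proof (rule that)
    fix v e \<gamma> c
    assume v: "v \<in> V" and e: "e \<in> Z2_power t" and g: "\<gamma> \<in> Z2_power t" and c: "c < d"
    let ?X = "{h. h < t \<and> e $ h = 0 \<and> \<gamma> $ h = 1}" and ?Y = "{h. h < t \<and> e $ h = 1 \<and> \<gamma> $ h = 1}"
    have pc: "p (v, e) \<in> carrier_vec d" using p v e by (simp add: extr_verts_def)
    have car: "finsum_vec TYPE(real) d \<tau> S \<in> carrier_vec d" if "S \<subseteq> {..<t}" for S
      by (rule finsum_vec_closed) (use that tau in auto)
    have idx: "finsum_vec TYPE(real) d \<tau> S $ c = (\<Sum>h\<in>S. \<tau> h $ c)" if "S \<subseteq> {..<t}" for S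
      by (rule index_finsum_vec) (use that tau c finite_subset in auto)
    have X: "?X \<subseteq> {..<t}" and Y: "?Y \<subseteq> {..<t}" by auto
    have "p (v, e + \<gamma>) $ c = p (v, e) $ c + (\<Sum>h\<in>?X. \<tau> h $ c) - (\<Sum>h\<in>?Y. \<tau> h $ c)"
      using sym[OF v e g] car[OF X] car[OF Y] idx[OF X] idx[OF Y] pc c by (simp add: extr_act_def)
    \<comment> \<open>Both sums are extended by zeros to all h < t. At each h at most one of them
      contributes, so their difference becomes one sum of signed terms that can be compared
      termwise.\<close>
    also have "(\<Sum>h\<in>?X. \<tau> h $ c) = (\<Sum>h<t. if e $ h = 0 \<and> \<gamma> $ h = 1 then \<tau> h $ c else 0)"
      by (intro sum.mono_neutral_cong_left) auto
    also have "(\<Sum>h\<in>?Y. \<tau> h $ c) = (\<Sum>h<t. if e $ h = 1 \<and> \<gamma> $ h = 1 then \<tau> h $ c else 0)"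
      by (intro sum.mono_neutral_cong_left) auto
    also have "p (v, e) $ c + (\<Sum>h<t. if e $ h = 0 \<and> \<gamma> $ h = 1 then \<tau> h $ c else 0)
        - (\<Sum>h<t. if e $ h = 1 \<and> \<gamma> $ h = 1 then \<tau> h $ c else 0)
      = p (v, e) $ c + (\<Sum>h<t. (if e $ h = 0 \<and> \<gamma> $ h = 1 then \<tau> h $ c else 0)
        - (if e $ h = 1 \<and> \<gamma> $ h = 1 then \<tau> h $ c else 0))"
      by (simp add: sum_subtractf)
    also have "(\<Sum>h<t. (if e $ h = 0 \<and> \<gamma> $ h = 1 then \<tau> h $ c else 0)
        - (if e $ h = 1 \<and> \<gamma> $ h = 1 then \<tau> h $ c else 0))
      = (\<Sum>h<t. if \<gamma> $ h = 1 then if e $ h = 0 then \<tau> h $ c else - (\<tau> h $ c) else 0)"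
    proof (rule sum.cong[OF refl])
      fix h
      show "(if e $ h = 0 \<and> \<gamma> $ h = 1 then \<tau> h $ c else 0) - (if e $ h = 1 \<and> \<gamma> $ h = 1 then \<tau> h $ c else 0)
        = (if \<gamma> $ h = 1 then if e $ h = 0 then \<tau> h $ c else - (\<tau> h $ c) else 0)"
        by (cases "e $ h"; cases "\<gamma> $ h") simp_all
    qed
    finally show "p (v, e + \<gamma>) $ c = p (v, e) $ c
      + (\<Sum>h<t. if \<gamma> $ h = 1 then if e $ h = 0 then (\<lambda>c h. \<tau> h $ c) c h else - (\<lambda>c h. \<tau> h $ c) c h else 0)"
      by simp
  qed
qed

text \<open>The displacement of a vertex depends only on its bit vector and \<gamma>, so both ends
  of a copy of an edge of H move alike. The displacements at the ends of a fibre edge differ only in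
  direction h, where they are opposite; if \<gamma> has a 1 there, their difference is minus twice
  the edge vector, which negates it.\<close>

lemma edge_vector_act:
  assumes G: "fin_simple_graph V E" and sym: "extrusion_symmetric d t V p"
    and p: "\<And>i. i \<in> extr_verts t V \<Longrightarrow> p i \<in> carrier_vec d"
    and g: "\<gamma> \<in> Z2_power t" and ij: "{i, j} \<in> extr_edges t V E" and c: "c < d"
  shows "p (extr_act \<gamma> i) $ c - p (extr_act \<gamma> j) $ c = edge_sign t \<gamma> {i, j} * (p i $ c - p j $ c)"
proof -
  obtain T :: "nat \<Rightarrow> nat \<Rightarrow> real" where
    T: "\<And>v e \<gamma> c. v \<in> V \<Longrightarrow> e \<in> Z2_power t \<Longrightarrow> \<gamma> \<in> Z2_power t \<Longrightarrow> c < d \<Longrightarrow>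
      p (v, e + \<gamma>) $ c = p (v, e) $ c + (\<Sum>h<t. if \<gamma> $ h = 1 then if e $ h = 0 then T c h else - T c h else 0)"
    using extrusion_symmetric_component[OF sym p] by blast
  from G ij show ?thesis
  proof (cases rule: extr_edgeE)
    case (base v w e)
    then have "edge_sign t \<gamma> {i, j} = 1" by (simp add: edge_sign_def reversed_edge_base)
    moreover have "i = (v, e) \<and> j = (w, e) \<or> i = (w, e) \<and> j = (v, e)"
      using base(1) by (auto simp: doubleton_eq_iff)
    ultimately show ?thesis
      using T[OF base(4,6) g c] T[OF base(5,6) g c] by (auto simp: extr_act_def)
  next
    case (fibre v e e' h)
    have h: "h < t" "\<And>k. k < t \<Longrightarrow> k \<noteq> h \<Longrightarrow> e $ k = e' $ k" "e $ h \<noteq> e' $ h"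
      using fibre(5) by (auto simp: differ_only_at_def)
    let ?s = "\<lambda>e k. if e $ k = 0 then T c k else - T c k"
    \<comment> \<open>The symmetry hypothesis applied with the unit vector as group element yields
      the fibre edge vector itself.\<close>
    have e': "e' = e + unit_vec t h"
    proof (rule eq_vecI)
      fix k assume "k < dim_vec (e + unit_vec t h)"
      then have "k < t" by simp
      then show "e' $ k = (e + unit_vec t h) $ k"
        using h fibre(3) by (cases "k = h"; cases "e $ k"; cases "e' $ k") (auto simp: Z2_power_def)
    qed (use fibre(4) in \<open>simp add: Z2_power_def\<close>)
    have "p (v, e') $ c = p (v, e) $ c + (\<Sum>k<t. if (unit_vec t h :: bit vec) $ k = 1 then ?s e k else 0)"
      unfolding e' using T[OF fibre(2,3) _ c, of "unit_vec t h"] by (simp add: Z2_power_def)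
    also have "(\<Sum>k<t. if (unit_vec t h :: bit vec) $ k = 1 then ?s e k else 0) = (\<Sum>k<t. if k = h then ?s e k else 0)"
      by (rule sum.cong) (use h in auto)
    finally have d1: "p (v, e') $ c = p (v, e) $ c + ?s e h" using h(1) by simp
    have "(p (v, e + \<gamma>) $ c - p (v, e' + \<gamma>) $ c) - (p (v, e) $ c - p (v, e') $ c)
      = (\<Sum>k<t. (if \<gamma> $ k = 1 then ?s e k else 0) - (if \<gamma> $ k = 1 then ?s e' k else 0))"
      unfolding T[OF fibre(2,3) g c] T[OF fibre(2,4) g c] by (simp add: sum_subtractf)
    also have "\<dots> = (\<Sum>k<t. if k = h then if \<gamma> $ h = 1 then ?s e h - ?s e' h else 0 else 0)"
      by (rule sum.cong) (use h(2) in auto)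
    also have "\<dots> = (if \<gamma> $ h = 1 then ?s e h - ?s e' h else 0)" using h(1) by simp
    \<comment> \<open>The bits of e and e' at h differ, so the two signed terms are negatives of
      each other.\<close>
    also have "\<dots> = (if \<gamma> $ h = 1 then 2 * ?s e h else 0)"
      using h(3) by (cases "e $ h"; cases "e' $ h") simp_all
    finally have d2: "p (v, e + \<gamma>) $ c - p (v, e' + \<gamma>) $ c
        = (if \<gamma> $ h = 1 then - 1 else 1) * (p (v, e) $ c - p (v, e') $ c)"
      using d1 by (simp split: if_splits)
    have sgn: "edge_sign t \<gamma> {i, j} = (if \<gamma> $ h = 1 then - 1 else 1)"
      unfolding fibre(1) edge_sign_def reversed_edge_fibre[OF fibre(3-5)] ..
    have "i = (v, e) \<and> j = (v, e') \<or> i = (v, e') \<and> j = (v, e)"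
      using fibre(1) by (auto simp: doubleton_eq_iff)
    then show ?thesis using d2 unfolding sgn extr_act_def by (auto simp: algebra_simps)
  qed
qed

text \<open>An entry of the rigidity matrix as a function of labels instead of indices, the form
  that \<open>signed_action_intertwiner\<close> takes.\<close>

definition edge_entry :: "('a \<Rightarrow> real vec) \<Rightarrow> 'a set \<Rightarrow> 'a \<times> nat \<Rightarrow> real" where
  "edge_entry p f = (\<lambda>(i, c). if i \<in> f then (p i - p (THE j. f = {i, j})) $ c else 0)"

lemma rigidity_matrix_eq:
  "rigidity_matrix d vs es p
    = mat (length es) (d * length vs) (\<lambda>(a, k). edge_entry p (es ! a) (vs ! (k div d), k mod d))"
  by (rule eq_matI) (simp_all add: rigidity_matrix_def edge_entry_def Let_def)

text \<open>This is \<open>edge_vector_act\<close> with the sign moved to the other side, which is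
  possible because it squares to 1.\<close>

lemma edge_entry_act:
  assumes G: "fin_simple_graph V E" and sym: "extrusion_symmetric d t V p"
    and p: "\<And>i. i \<in> extr_verts t V \<Longrightarrow> p i \<in> carrier_vec d"
    and g: "\<gamma> \<in> Z2_power t" and f: "f \<in> extr_edges t V E" and i: "i \<in> extr_verts t V" and c: "c < d"
  shows "edge_sign t \<gamma> f * edge_entry p (extr_act_edge \<gamma> f) (extr_act \<gamma> i, c) = edge_entry p f (i, c)"
proof -
  \<comment> \<open>The definite description in the rigidity matrix picks out the other
    endpoint.\<close>
  have the: "(THE j. {i, k} = {i, j}) = k" for i k :: "'a \<times> bit vec"
    by (rule the_equality) (auto simp: doubleton_eq_iff)
  have inv: "extr_act \<gamma> (extr_act \<gamma> j) = j" if "j \<in> extr_verts t V" for j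
    using extr_act_add[OF g g that] extr_act_zero[OF that] g by simp
  have mem: "extr_act \<gamma> i \<in> extr_act_edge \<gamma> f \<longleftrightarrow> i \<in> f"
  proof
    assume "extr_act \<gamma> i \<in> extr_act_edge \<gamma> f"
    then obtain j where j: "j \<in> f" "extr_act \<gamma> i = extr_act \<gamma> j" unfolding extr_act_edge_def by blast
    then have "j \<in> extr_verts t V" using extr_edge_subset[OF G f] by blast
    then have "i = j" using arg_cong[OF j(2), of "extr_act \<gamma>"] unfolding inv[OF i] by (simp only: inv)
    then show "i \<in> f" using j(1) by simp
  qed (simp add: extr_act_edge_def)
  show ?thesis
  proof (cases "i \<in> f")
    case True
    obtain j where fj: "f = {i, j}"
      using G f True by (cases rule: extr_edgeE) auto
    have j: "j \<in> extr_verts t V" using extr_edge_subset[OF G f] fj by auto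
    have "dim_vec (p k) = d" "dim_vec (p (extr_act \<gamma> k)) = d" if "k \<in> extr_verts t V" for k
      using p that extr_act_closed[OF g that] carrier_vecD by blast+
    then have "edge_entry p f (i, c) = p i $ c - p j $ c"
      and "edge_entry p (extr_act_edge \<gamma> f) (extr_act \<gamma> i, c) = p (extr_act \<gamma> i) $ c - p (extr_act \<gamma> j) $ c"
      using i j c unfolding fj edge_entry_def by (simp_all add: the)
    then show ?thesis
      using edge_vector_act[OF G sym p g f[unfolded fj] c] unfolding fj by (simp add: edge_sign_def)
  qed (simp add: edge_entry_def mem)
qed

theorem corollary2p3:
  fixes V\<^sub>H :: "'a set" and E\<^sub>H :: "'a set set"
    and t d :: nat
    and p :: "'a \<times> bit vec \<Rightarrow> real vec"
    and vs :: "('a \<times> bit vec) list" and es :: "('a \<times> bit vec) set list"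
    and \<iota> :: "nat \<Rightarrow> bit vec"
  assumes "fin_simple_graph V\<^sub>H E\<^sub>H"
    and "t \<ge> 1"
    and "distinct vs" and "set vs = extr_verts t V\<^sub>H"
    and "distinct es" and "set es = extr_edges t V\<^sub>H E\<^sub>H"
    and "framework d (extr_verts t V\<^sub>H) (extr_edges t V\<^sub>H E\<^sub>H) p"
    and "extrusion_symmetric d t V\<^sub>H p"
    and "bij_betw \<iota> {..<2 ^ t} (Z2_power t)"
  shows "\<exists>A B Rs.
    A \<in> carrier_mat (d * length vs) (d * length vs) \<and> invertible_mat A \<and>
    B \<in> carrier_mat (length es) (length es) \<and> invertible_mat B \<and>
    length Rs = 2 ^ t \<and>
    transpose_mat B * rigidity_matrix d vs es p * A = diag_block_mat Rs \<and>
    (\<forall>\<kappa><2 ^ t.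
       is_basis_of (d * length vs) (block_columns Rs \<kappa> A)
         (isotypic_subspace t (d * length vs) (external_rep d vs) (irrep t (\<iota> \<kappa>))) \<and>
       is_basis_of (length es) (block_rows Rs \<kappa> B)
         (isotypic_subspace t (length es) (internal_rep t es) (irrep t (\<iota> \<kappa>))))"
proof -
  let ?act = "\<lambda>\<gamma> (i :: 'a \<times> bit vec, c :: nat). (extr_act \<gamma> i, c)"
  note G = assms(1) and vs = assms(3,4) and es = assms(5,6)
  have p: "p i \<in> carrier_vec d" if "i \<in> extr_verts t V\<^sub>H" for i
    using assms(7) that by (simp add: framework_def)
  have V: "signed_action t (d * length vs) (\<lambda>k. (vs ! (k div d), k mod d)) (extr_verts t V\<^sub>H \<times> {..<d})
      ?act (\<lambda>_ _. 1)"
    using external_rep_signed_action[OF vs] .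
  have E: "signed_action t (length es) ((!) es) (extr_edges t V\<^sub>H E\<^sub>H) extr_act_edge (edge_sign t)"
    using internal_rep_signed_action[OF G es] .
  have "internal_rep t es \<gamma> * rigidity_matrix d vs es p = rigidity_matrix d vs es p * external_rep d vs \<gamma>"
    if g: "\<gamma> \<in> Z2_power t" for \<gamma>
    unfolding external_rep_eq_rep[OF vs] internal_rep_eq_rep[OF G es g] rigidity_matrix_eq
  \<comment> \<open>With all three matrices expressed through labels, what remains is the
    equivariance of single entries; the sign on the vertex side is 1.\<close>
  proof (rule signed_action_intertwiner[OF V E _ g])
    fix \<gamma> x f assume g: "\<gamma> \<in> Z2_power t" and x: "x \<in> extr_verts t V\<^sub>H \<times> {..<d}" and f: "f \<in> extr_edges t V\<^sub>H E\<^sub>H"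
    obtain i c where "x = (i, c)" "i \<in> extr_verts t V\<^sub>H" "c < d" using x by blast
    then show "edge_sign t \<gamma> f * edge_entry p (extr_act_edge \<gamma> f) (?act \<gamma> x) = edge_entry p f x * 1"
      using edge_entry_act[OF G assms(8) p g f] by simp
  qed
  moreover have "Z2_representation t (d * length vs) (external_rep d vs)"
    by (rule Z2_representation_cong[OF signed_action.Z2_representation_rep[OF V]]) (rule external_rep_eq_rep[OF vs])
  moreover have "Z2_representation t (length es) (internal_rep t es)"
    by (rule Z2_representation_cong[OF signed_action.Z2_representation_rep[OF E]]) (rule internal_rep_eq_rep[OF G es])
  moreover have "rigidity_matrix d vs es p \<in> carrier_mat (length es) (d * length vs)"
    by (simp add: rigidity_matrix_def)
  ultimately show ?thesis
    using assms(9) by (intro intertwiner_block_diagonal)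
qed

end
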